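(* Let $\Omega_h=\{(x,y)\in\mathbb{R}^2: x^2+y^2<1,\ y>0\}$ and let $\gamma\in L^2(\Omega_h)$ be real-valued. Then $\gamma$ is uniquely determined by the linearized incomplete Dirichlet-to-Neumann map ${\Lambda^{inc}_{1,\gamma}}'$ (see context). In fact, it suffices to know the values $\langle{\Lambda^{inc}_{1,\gamma}}'f,g\rangle$ for $f(\phi)=\sin(n\phi)$ and $g(\phi)=\sin(k\phi)$, $\phi\in[0,\pi]$, $n,k=1,2,\dots$; that is, if $\gamma_1,\gamma_2\in L^2(\Omega_h)$ satisfy $\langle{\Lambda^{inc}_{1,\gamma_1}}'\sin(n\cdot),\sin(k\cdot)\rangle=\langle{\Lambda^{inc}_{1,\gamma_2}}'\sin(n\cdot),\sin(k\cdot)\rangle$ for all integers $n,k\ge1$, then $\gamma_1=\gamma_2$ almost everywhere in $\Omega_h$.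
   Context: Let $\Gamma=\partial\Omega_h\cap\{y>0\}$ (upper half circle, parametrized by the polar angle $\phi\in(0,\pi)$) and $\Gamma_0=\partial\Omega_h\cap\{y=0\}$. For $f$ on $\Gamma$ whose extension by zero to $\Gamma_0$ lies in $H^{1/2}(\partial\Omega_h)$, let $u_{f,1}\in H^1(\Omega_h)$ be the solution of $\Delta u_{f,1}=0$ in $\Omega_h$, $u_{f,1}=f$ on $\Gamma$, $u_{f,1}=0$ on $\Gamma_0$. The linearized incomplete Dirichlet-to-Neumann map is given by $$\langle{\Lambda^{inc}_{1,\gamma}}'f,g\rangle=\int_{\Omega_h}\gamma\,\nabla u_{f,1}\cdot\nabla u_{g,1}\,dx$$ for those $f,g$ for which the integral converges absolutely. For $f=\sin(n\phi)$ the solution is $u_{f,1}(r,\phi)=r^n\sin(n\phi)$, so the values in question are always defined. *)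

theory Defs
  imports "HOL-Analysis.Analysis"
begin

definition L2 :: "'a measure \<Rightarrow> ('a \<Rightarrow> 'b::euclidean_space) \<Rightarrow> bool" where
  "L2 M f \<longleftrightarrow> f \<in> borel_measurable M \<and> integrable M (\<lambda>x. (norm (f x))\<^sup>2)"

(* GDERIV f x :> D says that D is the (classical) gradient of f at x. *)
definition C1 :: "('a::euclidean_space \<Rightarrow> real) \<Rightarrow> bool" where
  "C1 f \<longleftrightarrow> (\<exists>D. (\<forall>x. GDERIV f x :> D x) \<and> continuous_on UNIV D)"

definition grad :: "('a::euclidean_space \<Rightarrow> real) \<Rightarrow> 'a \<Rightarrow> 'a" where
  "grad f x = (THE D. GDERIV f x :> D)"

(* Continuously differentiable with compact support in the open set Om, extended by zero. *)
definition C1_0 :: "'a::euclidean_space set \<Rightarrow> ('a \<Rightarrow> real) \<Rightarrow> bool" where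
  "C1_0 Om f \<longleftrightarrow> C1 f \<and> (\<exists>K. compact K \<and> K \<subseteq> Om \<and> (\<forall>x. x \<notin> K \<longrightarrow> f x = 0))"

(* u and U are square integrable on Om, and U is the distributional gradient of u.
   As in Gilbarg-Trudinger, first-order weak derivatives are tested against C1_0. *)
definition has_weak_gradient ::
  "'a::euclidean_space set \<Rightarrow> ('a \<Rightarrow> real) \<Rightarrow> ('a \<Rightarrow> 'a) \<Rightarrow> bool" where
  "has_weak_gradient Om u U \<longleftrightarrow>
     L2 (lebesgue_on Om) u \<and> L2 (lebesgue_on Om) U \<and>
     (\<forall>p. C1_0 Om p \<longrightarrow>
        (LINT x|lebesgue_on Om. u x *\<^sub>R grad p x) = - (LINT x|lebesgue_on Om. p x *\<^sub>R U x))"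

definition H1 :: "'a::euclidean_space set \<Rightarrow> ('a \<Rightarrow> real) set" where
  "H1 Om = {u. \<exists>U. has_weak_gradient Om u U}"

(* Determined up to a null set; only used under integrals. *)
definition weak_grad :: "'a::euclidean_space set \<Rightarrow> ('a \<Rightarrow> real) \<Rightarrow> 'a \<Rightarrow> 'a" where
  "weak_grad Om u = (SOME U. has_weak_gradient Om u U)"

definition weakly_harmonic :: "'a::euclidean_space set \<Rightarrow> ('a \<Rightarrow> real) \<Rightarrow> bool" where
  "weakly_harmonic Om u \<longleftrightarrow>
     u \<in> H1 Om \<and>
     (\<forall>p. C1_0 Om p \<longrightarrow> (LINT x|lebesgue_on Om. weak_grad Om u x \<bullet> grad p x) = 0)"

definition Omega_h :: "(real \<times> real) set" where
  "Omega_h = {(x, y). x\<^sup>2 + y\<^sup>2 < 1 \<and> y > 0}"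

(* Arc length parametrization of the boundary of Omega_h on [0, pi + 2): first the half circle
   (where s is the polar angle), then the diameter from (-1, 0) to (1, 0).
   Functions on the boundary are represented by functions of s. *)
definition bdry :: "real \<Rightarrow> real \<times> real" where
  "bdry s = (if s \<le> pi then (cos s, sin s) else (s - pi - 1, 0))"

definition bdry_measure :: "real measure" where
  "bdry_measure = lebesgue_on {0..<pi + 2}"

(* H^{1/2} of the (one-dimensional) boundary, via the Gagliardo seminorm with respect to
   the Euclidean distance of the boundary points. *)
definition H_half :: "(real \<Rightarrow> real) \<Rightarrow> bool" where
  "H_half h \<longleftrightarrow>
     L2 bdry_measure h \<and>
     (\<integral>\<^sup>+ s. \<integral>\<^sup>+ t. ennreal ((h s - h t)\<^sup>2 / (dist (bdry s) (bdry t))\<^sup>2)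
        \<partial>bdry_measure \<partial>bdry_measure) < \<infinity>"

(* The trace operator is the continuous extension, from H1 to L2 of the boundary, of
   restriction to the boundary for functions that are C1 up to the boundary. *)
definition has_trace :: "(real \<times> real \<Rightarrow> real) \<Rightarrow> (real \<Rightarrow> real) \<Rightarrow> bool" where
  "has_trace u h \<longleftrightarrow>
     u \<in> H1 Omega_h \<and> L2 bdry_measure h \<and>
     (\<exists>w :: nat \<Rightarrow> real \<times> real \<Rightarrow> real.
        (\<forall>i. C1 (w i)) \<and>
        (\<lambda>i. LINT x|lebesgue_on Omega_h. (w i x - u x)\<^sup>2) \<longlonglongrightarrow> 0 \<and>
        (\<lambda>i. LINT x|lebesgue_on Omega_h. (norm (grad (w i) x - weak_grad Omega_h u x))\<^sup>2)
          \<longlonglongrightarrow> 0 \<and>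
        (\<lambda>i. LINT s|bdry_measure. (w i (bdry s) - h s)\<^sup>2) \<longlonglongrightarrow> 0)"

(* f is a function of the polar angle; the result is its extension by zero to the diameter. *)
definition ext0 :: "(real \<Rightarrow> real) \<Rightarrow> real \<Rightarrow> real" where
  "ext0 f s = (if 0 < s \<and> s < pi then f s else 0)"

definition u1 :: "(real \<Rightarrow> real) \<Rightarrow> real \<times> real \<Rightarrow> real" where
  "u1 f = (SOME u. weakly_harmonic Omega_h u \<and> has_trace u (ext0 f))"

(* The linearized incomplete Dirichlet-to-Neumann map in direction gamma as a partial
   bilinear form: None outside its domain, i.e. if f or g is not admissible or the integral
   does not converge absolutely. *)
definition DN_inc_lin ::
  "(real \<times> real \<Rightarrow> real) \<Rightarrow> (real \<Rightarrow> real) \<Rightarrow> (real \<Rightarrow> real) \<Rightarrow> real option" where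
  "DN_inc_lin \<gamma> f g =
     (let F = (\<lambda>x. \<gamma> x * (weak_grad Omega_h (u1 f) x \<bullet> weak_grad Omega_h (u1 g) x)) in
      if H_half (ext0 f) \<and> H_half (ext0 g) \<and> integrable (lebesgue_on Omega_h) F
      then Some (LINT x|lebesgue_on Omega_h. F x)
      else None)"

end

theory Submission
  imports Defs
begin

text \<open>The solution with boundary values \<open>sin (n\<phi>)\<close> is \<open>Im z\<^sup>n\<close>, and
  \<open>\<nabla>(Im z\<^sup>n) \<bullet> \<nabla>(Im z\<^sup>k) = n k Re (z\<^sup>n\<^sup>-\<^sup>1 cnj z\<^sup>k\<^sup>-\<^sup>1)\<close>. The real span of these functions is an algebra
  that contains the constants and, because of \<open>x = Re z\<close> and \<open>x\<^sup>2 + y\<^sup>2 = z cnj z\<close>, separates the points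
  of the closed upper half disc; so by Stone-Weierstrass the difference of the two coefficients is
  orthogonal to every continuous function. That the solution is unique is shown without an
  \<open>H\<^sub>0\<^sup>1\<close> theory: a weakly harmonic function with zero trace is tested with its approximants times a
  cutoff, and the error is bounded by a Poincare inequality in a thin strip along the boundary.\<close>

section \<open>Continuously differentiable functions\<close>

text \<open>Both \<open>u1\<close> and \<open>weak_grad\<close> are choices among functions with
  given properties, so nothing can be computed before these properties are known to fix the
  gradients almost everywhere; the two uniqueness arguments serve this purpose. In both, the class
  of test functions is the obstacle: it contains no nonzero constants, and the approximants in the
  definition of the trace need not vanish on the boundary. Everything therefore passes through one
  explicit C1 cutoff with two scales, a gradient of order 1/d and a strip of width of order d. These
  powers of d cancel, and what must become small is only the energy of a fixed L2 field in the
  strip. The order of the limits matters: first the approximation index, then d.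

  The last step depends on the shape of the domain. The products of gradients are invariant under
  complex conjugation, so on the full disc they would annihilate every coefficient that is odd in y;
  on the upper half, functions even in y can still separate points.\<close>

lemma C1_I:
  assumes "\<And>x. GDERIV f x :> D x" "continuous_on UNIV D"
  shows "C1 f"
  unfolding C1_def using assms by blast

lemma grad_eqI: "GDERIV f x :> D \<Longrightarrow> grad f x = D"
  unfolding grad_def
proof (rule the_equality)
  fix E assume D: "GDERIV f x :> D" and E: "GDERIV f x :> E"
  have "(\<lambda>h. h \<bullet> D) = (\<lambda>h. h \<bullet> E)"
    using has_derivative_unique D E unfolding gderiv_def by blast
  then have "(E - D) \<bullet> D = (E - D) \<bullet> E" by metis
  then have "(E - D) \<bullet> (E - D) = 0" by (simp add: inner_diff_right)
  then show "E = D" by simp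
qed

lemma C1_GDERIV: "C1 f \<Longrightarrow> GDERIV f x :> grad f x"
  unfolding C1_def using grad_eqI by metis

lemma C1_has_derivative: "C1 f \<Longrightarrow> (f has_derivative (\<lambda>h. h \<bullet> grad f x)) (at x)"
  using C1_GDERIV unfolding gderiv_def .

lemma C1_continuous_grad: "C1 f \<Longrightarrow> continuous_on S (grad f)"
proof -
  assume "C1 f"
  then obtain D where D: "\<And>x. GDERIV f x :> D x" "continuous_on UNIV D"
    unfolding C1_def by blast
  then have "grad f = D" using grad_eqI by blast
  then show ?thesis using D continuous_on_subset by blast
qed

lemma C1_continuous: "C1 f \<Longrightarrow> continuous_on S f"
  by (meson C1_has_derivative continuous_at_imp_continuous_on has_derivative_continuous)

lemma C1_const: "C1 (\<lambda>x. c)"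
  by (rule C1_I[OF GDERIV_const]) simp

lemma C1_add: "C1 f \<Longrightarrow> C1 g \<Longrightarrow> C1 (\<lambda>x. f x + g x)"
  by (rule C1_I[OF GDERIV_add[OF C1_GDERIV C1_GDERIV]])
     (auto intro!: continuous_intros C1_continuous_grad)

lemma C1_diff: "C1 f \<Longrightarrow> C1 g \<Longrightarrow> C1 (\<lambda>x. f x - g x)"
  by (rule C1_I[OF GDERIV_diff[OF C1_GDERIV C1_GDERIV]])
     (auto intro!: continuous_intros C1_continuous_grad)

lemma grad_diff: "C1 f \<Longrightarrow> C1 g \<Longrightarrow> grad (\<lambda>x. f x - g x) x = grad f x - grad g x"
  by (rule grad_eqI[OF GDERIV_diff[OF C1_GDERIV C1_GDERIV]])

lemma C1_mult: "C1 f \<Longrightarrow> C1 g \<Longrightarrow> C1 (\<lambda>x. f x * g x)"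
  by (rule C1_I[OF GDERIV_mult[OF C1_GDERIV C1_GDERIV]])
     (auto intro!: continuous_intros C1_continuous_grad C1_continuous)

lemma grad_mult:
  "C1 f \<Longrightarrow> C1 g \<Longrightarrow> grad (\<lambda>x. f x * g x) x = f x *\<^sub>R grad g x + g x *\<^sub>R grad f x"
  by (rule grad_eqI[OF GDERIV_mult[OF C1_GDERIV C1_GDERIV]])

lemma C1_inner: "C1 (\<lambda>x. x \<bullet> c)"
  by (rule C1_I[of _ "\<lambda>x. c"])
     (auto simp: gderiv_def intro!: derivative_eq_intros)

lemma GDERIV_compose_real:
  assumes "C1 f" "\<And>t. (g has_real_derivative g' t) (at t)"
  shows "GDERIV (\<lambda>x. g (f x)) x :> g' (f x) *\<^sub>R grad f x"
  using GDERIV_DERIV_compose[OF C1_GDERIV[OF assms(1)] assms(2)] .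

lemma C1_compose_real:
  assumes "C1 f" "\<And>t. (g has_real_derivative g' t) (at t)" "continuous_on UNIV g'"
  shows "C1 (\<lambda>x. g (f x))"
proof (rule C1_I[OF GDERIV_compose_real[OF assms(1,2)]])
  show "continuous_on UNIV (\<lambda>x. g' (f x) *\<^sub>R grad f x)"
    using C1_continuous_grad[OF assms(1)] continuous_on_compose2[OF assms(3) C1_continuous[OF assms(1)]]
    by (intro continuous_on_scaleR) auto
qed

lemma grad_outside_support:
  assumes "closed K" "\<And>x. x \<notin> K \<Longrightarrow> f x = 0" "x \<notin> K"
  shows "grad f x = 0"
proof (rule grad_eqI)
  have "(f has_derivative (\<lambda>h. 0)) (at x)"
    by (rule has_derivative_transform_within_open[of "\<lambda>_. 0" _ _ _ "- K"]) (use assms in auto)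
  then show "GDERIV f x :> 0" by (simp add: gderiv_def)
qed

lemma C1_0_mult: "C1_0 S p \<Longrightarrow> C1 f \<Longrightarrow> C1_0 S (\<lambda>x. p x * f x)"
  unfolding C1_0_def
proof (elim conjE exE, intro conjI)
  fix K
  assume K: "compact K" "K \<subseteq> S" "\<forall>x. x \<notin> K \<longrightarrow> p x = 0" and c: "C1 p" "C1 f"
  show "C1 (\<lambda>x. p x * f x)" using c by (rule C1_mult)
  show "\<exists>K. compact K \<and> K \<subseteq> S \<and> (\<forall>x. x \<notin> K \<longrightarrow> p x * f x = 0)"
    using K by (intro exI[of _ K]) simp
qed

text \<open>Compactness bounds the gradient and convexity keeps segments inside \<open>K\<close>, so
  the mean value inequality applies. The bound is used to dominate difference quotients and, later,
  the Gagliardo quotient on the boundary.\<close>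

lemma C1_Lipschitz_compact_convex:
  assumes "C1 f" "compact K" "convex K"
  obtains B where "B \<ge> 0" "\<And>x y. x \<in> K \<Longrightarrow> y \<in> K \<Longrightarrow> \<bar>f x - f y\<bar> \<le> B * dist x y"
proof -
  have "bounded (grad f ` K)"
    by (intro compact_imp_bounded compact_continuous_image C1_continuous_grad assms)
  then obtain B where B: "B > 0" "\<And>x. x \<in> K \<Longrightarrow> norm (grad f x) \<le> B"
    unfolding bounded_pos by auto
  have "norm (f x - f y) \<le> B * norm (x - y)" if "x \<in> K" "y \<in> K" for x y
  proof (rule differentiable_bound[OF assms(3)])
    show "(f has_derivative (\<lambda>h. h \<bullet> grad f z)) (at z within K)" for z
      using C1_has_derivative[OF assms(1)] by (rule has_derivative_at_withinI)
    show "onorm (\<lambda>h. h \<bullet> grad f z) \<le> B" if "z \<in> K" for z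
    proof (rule onorm_le)
      fix h
      have "norm (h \<bullet> grad f z) \<le> norm h * norm (grad f z)"
        using Cauchy_Schwarz_ineq2 by (simp add: real_norm_def)
      also have "\<dots> \<le> norm h * B" using B(2)[OF that] by (rule mult_left_mono) simp
      finally show "norm (h \<bullet> grad f z) \<le> B * norm h" by (simp add: mult.commute)
    qed
  qed (use that in auto)
  then show ?thesis using that[of B] B by (auto simp: dist_norm)
qed

section \<open>Integrals of compactly supported functions and their gradients\<close>

lemma integrable_compact_support:
  fixes h :: "'a::euclidean_space \<Rightarrow> 'b::euclidean_space"
  assumes "continuous_on UNIV h" "compact K" "\<And>x. x \<notin> K \<Longrightarrow> h x = 0"
  shows "integrable lborel h"
proof -
  have "integrable lborel (\<lambda>x. indicator K x *\<^sub>R h x)"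
    by (rule borel_integrable_compact[OF assms(2) continuous_on_subset[OF assms(1)]]) simp
  moreover have "(\<lambda>x. indicator K x *\<^sub>R h x) = h"
    using assms(3) by (auto simp: indicator_def fun_eq_iff)
  ultimately show ?thesis by simp
qed

text \<open>Difference quotients have integral zero by translation invariance of the Lebesgue measure.\<close>
lemma integral_grad_compact_support:
  fixes f :: "'a::euclidean_space \<Rightarrow> real"
  assumes f: "C1 f" and K: "compact K" "\<And>x. x \<notin> K \<Longrightarrow> f x = 0"
  shows "(LINT x|lborel. grad f x) = 0"
proof -
  obtain R where "R > 0" "K \<subseteq> ball 0 R"
    using bounded_subset_ballD[OF compact_imp_bounded[OF K(1)]] by blast
  then have R: "R > 0" "K \<subseteq> cball 0 R" using ball_subset_cball by auto
  have f0: "f x = 0" if "norm x > R" for x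
    using K(2) R that by (force simp: subset_iff)
  have g0: "grad f x = 0" if "norm x > R" for x
    by (rule grad_outside_support[of "cball 0 R"]) (use that f0 in auto)
  have intf: "integrable lborel f"
    by (rule integrable_compact_support[OF C1_continuous[OF f] K])
  have intg: "integrable lborel (grad f)"
    by (rule integrable_compact_support[OF C1_continuous_grad[OF f] compact_cball, of 0 R]) (simp add: g0)
  \<comment> \<open>The steps \<open>h n\<close> are at most 1: a point of norm at most R + 1 is
    moved to norm at most R + 2, where \<open>B\<close> is a Lipschitz constant, and for points
    farther out both values in the quotient vanish. This yields the dominating function
    below.\<close>
  obtain B where B: "B \<ge> 0"
      "\<And>x y. x \<in> cball 0 (R+2) \<Longrightarrow> y \<in> cball 0 (R+2) \<Longrightarrow> \<bar>f x - f y\<bar> \<le> B * dist x y"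
    by (rule C1_Lipschitz_compact_convex[OF f compact_cball convex_cball, of 0 "R+2"]) blast
  have "(LINT x|lborel. grad f x) \<bullet> e = 0" if e: "e \<in> Basis" for e
  proof -
    define h where "h n = 1 / real (Suc n)" for n
    have h: "h n > 0" "h n \<le> 1" for n by (auto simp: h_def field_simps)
    define q where "q n x = (f (x + h n *\<^sub>R e) - f x) / h n" for n x
    have nh: "norm (h n *\<^sub>R e) = h n" for n using e h[of n] by simp
    have shift: "integrable lborel (\<lambda>x. f (x + a))" "(LINT x|lborel. f (x + a)) = (LINT x|lborel. f x)"
      for a
    proof -
      have m: "f \<in> borel_measurable borel" using intf by simp
      show "integrable lborel (\<lambda>x. f (x + a))"
        using integrable_distr_eq[of "(+) a" lborel borel f] m intf
        by (simp add: lborel_distr_plus add.commute)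
      show "(LINT x|lborel. f (x + a)) = (LINT x|lborel. f x)"
        using integral_distr[of "(+) a" lborel borel f] m
        by (simp add: lborel_distr_plus add.commute)
    qed
    have q0: "(LINT x|lborel. q n x) = 0" for n
      unfolding q_def using shift intf by simp
    have "(\<lambda>n. LINT x|lborel. q n x) \<longlonglongrightarrow> (LINT x|lborel. grad f x \<bullet> e)"
    proof (rule integral_dominated_convergence[where w = "\<lambda>x. B * indicator (cball 0 (R+1)) x"])
      show "(\<lambda>x. grad f x \<bullet> e) \<in> borel_measurable lborel" using intg by auto
      show "q n \<in> borel_measurable lborel" for n
        unfolding q_def using shift(1) intf by (intro borel_measurable_divide borel_measurable_diff) auto
      show "integrable lborel (\<lambda>x::'a. B * indicator (cball 0 (R + 1)) x)"
        by (intro integrable_mult_right integrable_real_indicator)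
           (use emeasure_bounded_finite[OF bounded_cball, of 0 "R+1"] in auto)
      show "AE x in lborel. (\<lambda>n. q n x) \<longlonglongrightarrow> grad f x \<bullet> e"
      proof (rule AE_I2)
        fix x
        have 1: "((\<lambda>t. x + t *\<^sub>R e) has_derivative (\<lambda>t. t *\<^sub>R e)) (at 0)"
          by (auto intro!: derivative_eq_intros)
        have "((\<lambda>t. f (x + t *\<^sub>R e)) has_derivative (\<lambda>t. (t *\<^sub>R e) \<bullet> grad f x)) (at 0)"
          using has_derivative_compose[OF 1, of f "\<lambda>h. h \<bullet> grad f x"]
            C1_has_derivative[OF f, of x] by simp
        then have "((\<lambda>t. f (x + t *\<^sub>R e)) has_real_derivative (grad f x \<bullet> e)) (at 0)"
          unfolding has_field_derivative_def
          by (rule has_derivative_eq_rhs) (auto simp: inner_commute mult.commute)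
        then have *: "((\<lambda>t. (f (x + t *\<^sub>R e) - f x) / t) \<longlongrightarrow> grad f x \<bullet> e) (at 0)"
          by (simp add: DERIV_def)
        have "filterlim h (at 0) sequentially"
          unfolding filterlim_at
        proof
          show "eventually (\<lambda>n. h n \<in> UNIV \<and> h n \<noteq> 0) sequentially"
            using h(1) by (intro always_eventually allI) (metis UNIV_I less_irrefl)
          show "h \<longlonglongrightarrow> 0"
            unfolding h_def by (rule LIMSEQ_Suc[OF lim_1_over_n])
        qed
        from filterlim_compose[OF * this] show "(\<lambda>n. q n x) \<longlonglongrightarrow> grad f x \<bullet> e"
          by (simp add: q_def)
      qed
      show "AE x in lborel. norm (q n x) \<le> B * indicator (cball 0 (R + 1)) x" for n
      proof (rule AE_I2)
        fix x
        show "norm (q n x) \<le> B * indicator (cball 0 (R + 1)) x"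
        proof (cases "norm x \<le> R + 1")
          case True
          have "norm (x + h n *\<^sub>R e) \<le> R + 2"
            using norm_triangle_ineq[of x "h n *\<^sub>R e"] True h(2)[of n] nh[of n] by linarith
          then have "\<bar>f (x + h n *\<^sub>R e) - f x\<bar> \<le> B * h n"
            using B(2)[of x "x + h n *\<^sub>R e"] True nh[of n]
            by (auto simp only: dist_norm norm_minus_commute[of x] mem_cball diff_0 norm_minus_cancel
                abs_minus_commute add_diff_cancel_left')
          moreover have "norm (q n x) = \<bar>f (x + h n *\<^sub>R e) - f x\<bar> / h n"
            using h(1)[of n] by (simp add: q_def)
          moreover have "x \<in> cball 0 (R + 1)" using True by simp
          ultimately show ?thesis using h(1)[of n] by (simp add: pos_divide_le_eq)
        next
          case False
          have "norm x \<le> norm (x + h n *\<^sub>R e) + h n"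
            using norm_triangle_ineq4[of "x + h n *\<^sub>R e" "h n *\<^sub>R e"] nh[of n] by simp
          then have "norm (x + h n *\<^sub>R e) > R" using False h(2)[of n] by linarith
          moreover have "norm x > R" using False by simp
          ultimately have "q n x = 0" using f0 unfolding q_def by simp
          then show ?thesis using B(1) by simp
        qed
      qed
    qed
    then have "(LINT x|lborel. grad f x \<bullet> e) = 0" by (simp add: q0 LIMSEQ_const_iff)
    then show ?thesis using integral_inner_left[OF intg, of e] by simp
  qed
  then show ?thesis using euclidean_eqI[of "LINT x|lborel. grad f x" 0] by (simp only: inner_zero_left)
qed

section \<open>Testing against function rings\<close>

lemma integrable_mult_bounded:
  fixes f g :: "'a \<Rightarrow> real"
  assumes f: "integrable M f" and g: "g \<in> borel_measurable M"
    and B: "\<And>x. x \<in> space M \<Longrightarrow> \<bar>g x\<bar> \<le> B"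
  shows "integrable M (\<lambda>x. f x * g x)"
proof (rule Bochner_Integration.integrable_bound[of M "\<lambda>x. B * f x"])
  show "integrable M (\<lambda>x. B * f x)" using f by simp
  show "(\<lambda>x. f x * g x) \<in> borel_measurable M" using f g by (intro borel_measurable_times) auto
  show "AE x in M. norm (f x * g x) \<le> norm (B * f x)"
  proof (rule AE_I2)
    fix x assume "x \<in> space M"
    then have "\<bar>g x\<bar> \<le> \<bar>B\<bar>" using B[of x] by simp
    then show "norm (f x * g x) \<le> norm (B * f x)"
      using mult_right_mono[of "\<bar>g x\<bar>" "\<bar>B\<bar>" "\<bar>f x\<bar>"] by (simp add: abs_mult mult.commute)
  qed
qed

lemma continuous_on_compact_abs_bound:
  fixes h :: "'a::topological_space \<Rightarrow> real"
  assumes "compact K" "continuous_on K h"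
  obtains B where "\<And>x. x \<in> K \<Longrightarrow> \<bar>h x\<bar> \<le> B"
  using compact_imp_bounded[OF compact_continuous_image[OF assms(2,1)]]
  unfolding bounded_iff by auto

lemma integrable_mult_continuous:
  fixes f h :: "'a::euclidean_space \<Rightarrow> real"
  assumes "integrable (lebesgue_on S) f" "S \<in> sets lebesgue" "S \<subseteq> K" "compact K" "continuous_on K h"
  shows "integrable (lebesgue_on S) (\<lambda>x. f x * h x)"
proof -
  obtain B where "\<And>x. x \<in> K \<Longrightarrow> \<bar>h x\<bar> \<le> B"
    using continuous_on_compact_abs_bound assms(4,5) by blast
  then show ?thesis
    using assms continuous_imp_measurable_on_sets_lebesgue[OF continuous_on_subset[OF assms(5,3)] assms(2)]
    by (intro integrable_mult_bounded[where B = B]) auto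
qed

text \<open>Orthogonality passes from the ring to its uniform closure, because a uniform error is
  multiplied only by the L1 norm of \<open>f\<close>; by Stone-Weierstrass this closure contains
  every continuous function on \<open>K\<close>.\<close>

lemma integral_mult_continuous_eq_0:
  fixes f h :: "'a::euclidean_space \<Rightarrow> real"
  assumes R: "function_ring_on R K" and S: "S \<subseteq> K" "S \<in> sets lebesgue"
    and f: "integrable (lebesgue_on S) f"
    and 0: "\<And>q. q \<in> R \<Longrightarrow> (LINT x|lebesgue_on S. f x * q x) = 0"
    and h: "continuous_on K h"
  shows "(LINT x|lebesgue_on S. f x * h x) = 0"
proof -
  interpret function_ring_on R K by (rule R)
  let ?I = "LINT x|lebesgue_on S. \<bar>f x\<bar>"
  have I: "?I \<ge> 0" by simp
  have "\<bar>LINT x|lebesgue_on S. f x * h x\<bar> \<le> e" if e: "e > 0" for e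
  proof -
    \<comment> \<open>Adding 1 avoids a division by zero when \<open>f\<close> vanishes almost
      everywhere.\<close>
    define d where "d = e / (?I + 1)"
    have I1: "?I + 1 > 0" using I by linarith
    have d: "d > 0" using divide_pos_pos[OF e I1] unfolding d_def .
    obtain q where q: "q \<in> R" "\<And>x. x \<in> K \<Longrightarrow> \<bar>h x - q x\<bar> < d"
      using Stone_Weierstrass_basic[OF h d] by blast
    have ih: "integrable (lebesgue_on S) (\<lambda>x. f x * h x)"
      and iq: "integrable (lebesgue_on S) (\<lambda>x. f x * q x)"
      using integrable_mult_continuous[OF f S(2,1) compact] h continuous[OF q(1)] by auto
    have "\<bar>LINT x|lebesgue_on S. f x * h x\<bar> = \<bar>LINT x|lebesgue_on S. f x * h x - f x * q x\<bar>"
      using ih iq 0[OF q(1)] by simp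
    also have "\<dots> \<le> (LINT x|lebesgue_on S. d * \<bar>f x\<bar>)"
    proof (rule order_trans[OF integral_abs_bound integral_mono])
      show "integrable (lebesgue_on S) (\<lambda>x. \<bar>f x * h x - f x * q x\<bar>)" using ih iq by auto
      show "integrable (lebesgue_on S) (\<lambda>x. d * \<bar>f x\<bar>)" using f by auto
      fix x assume "x \<in> space (lebesgue_on S)"
      then have "\<bar>h x - q x\<bar> \<le> d" using q(2)[of x] S by auto
      then have "\<bar>f x\<bar> * \<bar>h x - q x\<bar> \<le> \<bar>f x\<bar> * d" by (rule mult_left_mono) simp
      then show "\<bar>f x * h x - f x * q x\<bar> \<le> d * \<bar>f x\<bar>"
        by (simp add: abs_mult right_diff_distrib[symmetric] mult.commute)
    qed
    also have "\<dots> = d * ?I" by simp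
    also have "\<dots> \<le> d * (?I + 1)" using d by (intro mult_left_mono) auto
    also have "\<dots> = e" using I1 unfolding d_def by simp
    finally show ?thesis .
  qed
  then have "\<bar>LINT x|lebesgue_on S. f x * h x\<bar> \<le> 0" by (rule field_le_epsilon) simp
  then show ?thesis by simp
qed

text \<open>Testing with \<open>sgn (f x)\<close> would give the L1 norm of \<open>f\<close>. The
  sign is an almost everywhere limit of continuous functions; truncating these to [-1, 1] does not
  change the limit and makes \<bar>f\<bar> a dominating function.\<close>

lemma AE_eq_0_of_function_ring:
  fixes f :: "'a::euclidean_space \<Rightarrow> real"
  assumes R: "function_ring_on R K" and S: "S \<subseteq> K" "S \<in> sets lebesgue"
    and f: "integrable (lebesgue_on S) f"
    and 0: "\<And>q. q \<in> R \<Longrightarrow> (LINT x|lebesgue_on S. f x * q x) = 0"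
  shows "AE x in lebesgue_on S. f x = 0"
proof -
  have "(\<lambda>x. sgn (f x)) \<in> borel_measurable (lebesgue_on S)" using f by auto
  then have "(\<lambda>x. sgn (f x)) measurable_on S" using measurable_on_iff_borel_measurable S by blast
  then obtain N g where N: "negligible N" and g: "\<And>n. continuous_on UNIV (g n)"
    and lim: "\<And>x. x \<notin> N \<Longrightarrow> (\<lambda>n. g n x) \<longlonglongrightarrow> (if x \<in> S then sgn (f x) else 0)"
    unfolding measurable_on_def by blast
  define h where "h n x = max (-1) (min 1 (g n x))" for n :: nat and x
  have h: "continuous_on A (h n)" for n A
    unfolding h_def using g continuous_on_subset by (intro continuous_intros) blast
  have h1: "\<bar>h n x\<bar> \<le> 1" for n x unfolding h_def by auto
  have AEN: "AE x in lebesgue_on S. x \<notin> N"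
  proof -
    have "AE x in lebesgue. x \<notin> N" using N by (simp add: AE_not_in negligible_iff_null_sets)
    then have "AE x in lebesgue. x \<in> S \<longrightarrow> x \<notin> N" by eventually_elim simp
    then show ?thesis using S by (simp add: AE_restrict_space_iff)
  qed
  have hm: "h n \<in> borel_measurable (lebesgue_on S)" for n
    using continuous_imp_measurable_on_sets_lebesgue h S(2) by blast
  have "(\<lambda>n. LINT x|lebesgue_on S. f x * h n x) \<longlonglongrightarrow> (LINT x|lebesgue_on S. \<bar>f x\<bar>)"
  proof (rule integral_dominated_convergence[where w = "\<lambda>x. \<bar>f x\<bar>"])
    show "(\<lambda>x. \<bar>f x\<bar>) \<in> borel_measurable (lebesgue_on S)" using f by auto
    show "integrable (lebesgue_on S) (\<lambda>x. \<bar>f x\<bar>)" using f by auto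
    show "(\<lambda>x. f x * h n x) \<in> borel_measurable (lebesgue_on S)" for n
      using f hm by (intro borel_measurable_times) auto
    show "AE x in lebesgue_on S. (\<lambda>n. f x * h n x) \<longlonglongrightarrow> \<bar>f x\<bar>"
    proof (rule AE_mp[OF AEN], rule AE_I2, rule impI)
      fix x assume x: "x \<in> space (lebesgue_on S)" "x \<notin> N"
      then have "(\<lambda>n. g n x) \<longlonglongrightarrow> sgn (f x)" using lim[of x] by simp
      then have "(\<lambda>n. f x * h n x) \<longlonglongrightarrow> f x * max (-1) (min 1 (sgn (f x)))"
        unfolding h_def by (intro tendsto_intros)
      moreover have "f x * max (-1) (min 1 (sgn (f x))) = \<bar>f x\<bar>" by (auto simp: sgn_if)
      ultimately show "(\<lambda>n. f x * h n x) \<longlonglongrightarrow> \<bar>f x\<bar>" by simp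
    qed
    show "AE x in lebesgue_on S. norm (f x * h n x) \<le> \<bar>f x\<bar>" for n
      using h1 by (auto simp: abs_mult intro!: AE_I2 mult_left_le)
  qed
  moreover have "(LINT x|lebesgue_on S. f x * h n x) = 0" for n
    by (rule integral_mult_continuous_eq_0[OF R S f 0 h])
  ultimately have "(LINT x|lebesgue_on S. \<bar>f x\<bar>) = 0" by (simp add: LIMSEQ_const_iff)
  then show ?thesis
    using integral_nonneg_eq_0_iff_AE[of "lebesgue_on S" "\<lambda>x. \<bar>f x\<bar>"] f by auto
qed

section \<open>Square integrable functions and weak gradients\<close>

lemma integral_lebesgue_on_eq_lborel:
  fixes f :: "'a::euclidean_space \<Rightarrow> 'b::euclidean_space"
  assumes "f \<in> borel_measurable borel" "S \<in> sets lebesgue" "\<And>x. x \<notin> S \<Longrightarrow> f x = 0"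
  shows "(LINT x|lebesgue_on S. f x) = (LINT x|lborel. f x)"
proof -
  have "(LINT x|lebesgue_on S. f x) = (LINT x|lebesgue. indicator S x *\<^sub>R f x)"
    using assms(2) by (simp add: integral_restrict_space)
  also have "(\<lambda>x. indicator S x *\<^sub>R f x) = f"
    using assms(3) by (auto simp: indicator_def fun_eq_iff)
  finally show ?thesis using assms(1) by (simp add: integral_completion)
qed

text \<open>The product of \<open>u\<close> and \<open>p\<close> is C1 on the whole space with
  compact support inside \<open>S\<close>, so its gradient has integral zero and no boundary term
  arises.\<close>

lemma integral_by_parts_C1_0:
  fixes u :: "'a::euclidean_space \<Rightarrow> real"
  assumes u: "C1 u" and p: "C1_0 S p" and S: "open S"
  shows "(LINT x|lebesgue_on S. u x *\<^sub>R grad p x) = - (LINT x|lebesgue_on S. p x *\<^sub>R grad u x)"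
proof -
  obtain K where K: "compact K" "K \<subseteq> S" "\<And>x. x \<notin> K \<Longrightarrow> p x = 0" and p1: "C1 p"
    using p unfolding C1_0_def by blast
  have gp: "grad p x = 0" if "x \<notin> K" for x
    using grad_outside_support[OF compact_imp_closed[OF K(1)] K(3) that] .
  have c1: "continuous_on UNIV (\<lambda>x. u x *\<^sub>R grad p x)" and c2: "continuous_on UNIV (\<lambda>x. p x *\<^sub>R grad u x)"
    using u p1 by (auto intro!: continuous_on_scaleR C1_continuous C1_continuous_grad)
  have i1: "integrable lborel (\<lambda>x. u x *\<^sub>R grad p x)"
    by (rule integrable_compact_support[OF c1 K(1)]) (simp add: gp)
  have i2: "integrable lborel (\<lambda>x. p x *\<^sub>R grad u x)"
    by (rule integrable_compact_support[OF c2 K(1)]) (simp add: K)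
  have "(LINT x|lborel. grad (\<lambda>x. u x * p x) x) = 0"
    by (rule integral_grad_compact_support[OF C1_mult[OF u p1] K(1)]) (simp add: K)
  then have "(LINT x|lborel. u x *\<^sub>R grad p x) + (LINT x|lborel. p x *\<^sub>R grad u x) = 0"
    using i1 i2 by (simp add: grad_mult[OF u p1])
  moreover have "S \<in> sets lebesgue" using S by auto
  moreover have "(LINT x|lebesgue_on S. u x *\<^sub>R grad p x) = (LINT x|lborel. u x *\<^sub>R grad p x)"
    by (rule integral_lebesgue_on_eq_lborel) (use i1 S gp K(2) in auto)
  moreover have "(LINT x|lebesgue_on S. p x *\<^sub>R grad u x) = (LINT x|lborel. p x *\<^sub>R grad u x)"
    by (rule integral_lebesgue_on_eq_lborel) (use i2 S K in auto)
  ultimately show ?thesis by (simp add: eq_neg_iff_add_eq_0)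
qed

lemma integrable_lebesgue_on_continuous:
  fixes h :: "'a::euclidean_space \<Rightarrow> real"
  assumes "bounded S" "S \<in> sets lebesgue" "continuous_on UNIV h"
  shows "integrable (lebesgue_on S) h"
proof -
  interpret finite_measure "lebesgue_on S"
    by (intro finite_measure_lebesgue_on bounded_set_imp_lmeasurable assms)
  have "integrable (lebesgue_on S) (\<lambda>x. 1 * h x)"
    by (rule integrable_mult_continuous[of S _ "closure S"])
       (use assms continuous_on_subset[OF assms(3)] closure_subset in auto)
  then show ?thesis by simp
qed

lemma L2_continuous:
  fixes f :: "'a::euclidean_space \<Rightarrow> 'b::euclidean_space"
  assumes "bounded S" "S \<in> sets lebesgue" "continuous_on UNIV f"
  shows "L2 (lebesgue_on S) f"
  unfolding L2_def
proof
  show "f \<in> borel_measurable (lebesgue_on S)"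
    using continuous_imp_measurable_on_sets_lebesgue[OF continuous_on_subset[OF assms(3)] assms(2)] by simp
  show "integrable (lebesgue_on S) (\<lambda>x. (norm (f x))\<^sup>2)"
    by (intro integrable_lebesgue_on_continuous continuous_intros assms)
qed

lemma has_weak_gradient_C1:
  fixes u :: "'a::euclidean_space \<Rightarrow> real"
  assumes "C1 u" "open S" "bounded S"
  shows "has_weak_gradient S u (grad u)"
proof -
  have "S \<in> sets lebesgue" using assms by auto
  from L2_continuous[OF assms(3) this C1_continuous[OF assms(1)]]
    L2_continuous[OF assms(3) this C1_continuous_grad[OF assms(1)]]
  show ?thesis
    unfolding has_weak_gradient_def
    by (intro conjI allI impI integral_by_parts_C1_0[OF assms(1) _ assms(2)])
qed

section \<open>Calculus of square integrable functions\<close>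

lemma L2_inner_integrable:
  fixes f g :: "'a \<Rightarrow> 'b::euclidean_space"
  assumes "L2 M f" "L2 M g"
  shows "integrable M (\<lambda>x. f x \<bullet> g x)"
proof (rule Bochner_Integration.integrable_bound[of M "\<lambda>x. (norm (f x))\<^sup>2 + (norm (g x))\<^sup>2"])
  show "integrable M (\<lambda>x. (norm (f x))\<^sup>2 + (norm (g x))\<^sup>2)" using assms by (auto simp: L2_def)
  show "(\<lambda>x. f x \<bullet> g x) \<in> borel_measurable M" using assms by (auto simp: L2_def)
  show "AE x in M. norm (f x \<bullet> g x) \<le> norm ((norm (f x))\<^sup>2 + (norm (g x))\<^sup>2)"
  proof (rule AE_I2)
    fix x
    have "norm (f x \<bullet> g x) \<le> norm (f x) * norm (g x)" by (simp add: Cauchy_Schwarz_ineq2)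
    also have "\<dots> \<le> (norm (f x))\<^sup>2 + (norm (g x))\<^sup>2"
      using sum_squares_bound[of "norm (f x)" "norm (g x)"]
        mult_nonneg_nonneg[OF norm_ge_zero[of "f x"] norm_ge_zero[of "g x"]] by linarith
    finally show "norm (f x \<bullet> g x) \<le> norm ((norm (f x))\<^sup>2 + (norm (g x))\<^sup>2)" by simp
  qed
qed

lemma norm_diff_squared_le:
  fixes a b :: "'b::real_inner"
  shows "(norm (a - b))\<^sup>2 \<le> 2 * (norm a)\<^sup>2 + 2 * (norm b)\<^sup>2"
proof -
  have "(norm (a - b))\<^sup>2 + (norm (a + b))\<^sup>2 = 2 * (norm a)\<^sup>2 + 2 * (norm b)\<^sup>2"
    by (simp add: power2_norm_eq_inner inner_simps inner_commute)
  then show ?thesis using zero_le_power2[of "norm (a + b)"] by linarith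
qed

lemma L2_diff:
  fixes f g :: "'a \<Rightarrow> 'b::euclidean_space"
  assumes "L2 M f" "L2 M g"
  shows "L2 M (\<lambda>x. f x - g x)"
  unfolding L2_def
proof
  show "(\<lambda>x. f x - g x) \<in> borel_measurable M" using assms by (auto simp: L2_def)
  show "integrable M (\<lambda>x. (norm (f x - g x))\<^sup>2)"
    by (rule Bochner_Integration.integrable_bound[of M "\<lambda>x. 2 * (norm (f x))\<^sup>2 + 2 * (norm (g x))\<^sup>2"])
       (use assms in \<open>auto simp: L2_def norm_diff_squared_le\<close>)
qed

lemma L2_scaleR_bounded:
  fixes f :: "'a \<Rightarrow> 'b::euclidean_space" and c :: "'a \<Rightarrow> real"
  assumes f: "L2 M f" and c: "c \<in> borel_measurable M" "\<And>x. x \<in> space M \<Longrightarrow> \<bar>c x\<bar> \<le> B"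
  shows "L2 M (\<lambda>x. c x *\<^sub>R f x)"
  unfolding L2_def
proof
  show "(\<lambda>x. c x *\<^sub>R f x) \<in> borel_measurable M" using f c by (auto simp: L2_def)
  have "integrable M (\<lambda>x. (norm (f x))\<^sup>2 * (c x)\<^sup>2)"
  proof (rule integrable_mult_bounded[where B = "B\<^sup>2"])
    fix x assume "x \<in> space M"
    then have "\<bar>c x\<bar>\<^sup>2 \<le> B\<^sup>2" using c(2) by (intro power_mono) auto
    then show "\<bar>(c x)\<^sup>2\<bar> \<le> B\<^sup>2" by simp
  qed (use f c in \<open>auto simp: L2_def\<close>)
  then show "integrable M (\<lambda>x. (norm (c x *\<^sub>R f x))\<^sup>2)"
    by (simp add: power_mult_distrib mult.commute)
qed

lemma (in finite_measure) L2_integrable: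
  fixes f :: "'a \<Rightarrow> 'b::euclidean_space"
  assumes "L2 M f"
  shows "integrable M f"
proof (rule Bochner_Integration.integrable_bound[of M "\<lambda>x. 1 + (norm (f x))\<^sup>2"])
  show "integrable M (\<lambda>x. 1 + (norm (f x))\<^sup>2)" using assms by (auto simp: L2_def)
  show "f \<in> borel_measurable M" using assms by (simp add: L2_def)
  show "AE x in M. norm (f x) \<le> norm (1 + (norm (f x))\<^sup>2)"
  proof (rule AE_I2)
    fix x
    have "0 \<le> (norm (f x) - 1)\<^sup>2" by simp
    then have "2 * norm (f x) \<le> 1 + (norm (f x))\<^sup>2" by (simp add: power2_diff)
    then have "norm (f x) \<le> 1 + (norm (f x))\<^sup>2" using norm_ge_zero[of "f x"] by linarith
    then show "norm (f x) \<le> norm (1 + (norm (f x))\<^sup>2)" by simp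
  qed
qed

text \<open>Pointwise, the weighted inequality of arithmetic and geometric mean bounds the product;
  its optimal weights are the quotients of the two norms. The slack \<open>e\<close> keeps these
  quotients meaningful when a norm is zero, and it is sent to 0 at the end.\<close>

lemma L2_Cauchy_Schwarz:
  fixes f g :: "'a \<Rightarrow> 'b::euclidean_space"
  assumes f: "L2 M f" and g: "L2 M g"
  shows "\<bar>LINT x|M. f x \<bullet> g x\<bar> \<le> sqrt (LINT x|M. (norm (f x))\<^sup>2) * sqrt (LINT x|M. (norm (g x))\<^sup>2)"
proof -
  define A where "A = (LINT x|M. (norm (f x))\<^sup>2)"
  define B where "B = (LINT x|M. (norm (g x))\<^sup>2)"
  have A: "A \<ge> 0" and B: "B \<ge> 0" by (auto simp: A_def B_def)
  have if2: "integrable M (\<lambda>x. (norm (f x))\<^sup>2)" and ig2: "integrable M (\<lambda>x. (norm (g x))\<^sup>2)"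
    using f g by (auto simp: L2_def)
  have main: "\<bar>LINT x|M. f x \<bullet> g x\<bar> \<le> (sqrt A + e) * (sqrt B + e)" if e: "e > 0" for e
  proof -
    define a where "a = sqrt A + e"
    define b where "b = sqrt B + e"
    have a: "a > 0" and b: "b > 0" using e A B by (auto simp: a_def b_def add_nonneg_pos)
    have "\<bar>LINT x|M. f x \<bullet> g x\<bar> \<le> (LINT x|M. (b / (2 * a)) * (norm (f x))\<^sup>2 + (a / (2 * b)) * (norm (g x))\<^sup>2)"
    proof (rule order_trans[OF integral_abs_bound integral_mono])
      show "integrable M (\<lambda>x. \<bar>f x \<bullet> g x\<bar>)" using L2_inner_integrable[OF f g] by auto
      show "integrable M (\<lambda>x. (b / (2 * a)) * (norm (f x))\<^sup>2 + (a / (2 * b)) * (norm (g x))\<^sup>2)"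
        using if2 ig2 by auto
      fix x
      have "0 \<le> (b * norm (f x) - a * norm (g x))\<^sup>2" by simp
      then have "2 * (a * b) * (norm (f x) * norm (g x)) \<le> b\<^sup>2 * (norm (f x))\<^sup>2 + a\<^sup>2 * (norm (g x))\<^sup>2"
        by (simp add: power2_eq_square algebra_simps)
      then have "norm (f x) * norm (g x) \<le> (b\<^sup>2 * (norm (f x))\<^sup>2 + a\<^sup>2 * (norm (g x))\<^sup>2) / (2 * (a * b))"
        using a b by (simp add: pos_le_divide_eq mult.commute)
      also have "\<dots> = (b / (2 * a)) * (norm (f x))\<^sup>2 + (a / (2 * b)) * (norm (g x))\<^sup>2"
        using a b by (simp add: add_divide_distrib power2_eq_square)
      finally have "norm (f x) * norm (g x) \<le> (b / (2 * a)) * (norm (f x))\<^sup>2 + (a / (2 * b)) * (norm (g x))\<^sup>2" .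
      then show "\<bar>f x \<bullet> g x\<bar> \<le> (b / (2 * a)) * (norm (f x))\<^sup>2 + (a / (2 * b)) * (norm (g x))\<^sup>2"
        using Cauchy_Schwarz_ineq2[of "f x" "g x"] by linarith
    qed
    also have "\<dots> = (b / (2 * a)) * A + (a / (2 * b)) * B"
      using if2 ig2 by (simp add: A_def B_def)
    also have "\<dots> \<le> (b / (2 * a)) * a\<^sup>2 + (a / (2 * b)) * b\<^sup>2"
    proof (intro add_mono mult_left_mono)
      have "(sqrt A)\<^sup>2 \<le> a\<^sup>2" using e A by (intro power_mono) (auto simp: a_def)
      then show "A \<le> a\<^sup>2" using A by simp
      have "(sqrt B)\<^sup>2 \<le> b\<^sup>2" using e B by (intro power_mono) (auto simp: b_def)
      then show "B \<le> b\<^sup>2" using B by simp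
    qed (use a b in auto)
    also have "\<dots> = a * b" using a b by (simp add: power2_eq_square)
    finally show ?thesis by (simp add: a_def b_def)
  qed
  have ev: "eventually (\<lambda>e. \<bar>LINT x|M. f x \<bullet> g x\<bar> \<le> (sqrt A + e) * (sqrt B + e)) (at_right 0)"
    by (rule eventually_mono[OF eventually_at_right_less[of 0]]) (rule main)
  have "((\<lambda>e. (sqrt A + e) * (sqrt B + e)) \<longlongrightarrow> (sqrt A + 0) * (sqrt B + 0)) (at_right 0)"
    by (intro tendsto_intros)
  then have "\<bar>LINT x|M. f x \<bullet> g x\<bar> \<le> (sqrt A + 0) * (sqrt B + 0)"
    by (rule tendsto_lowerbound[OF _ ev]) simp
  then show ?thesis by (simp add: A_def B_def)
qed

section \<open>Cutoff functions on the half disc\<close>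

lemma Omega_h_iff: "p \<in> Omega_h \<longleftrightarrow> p \<bullet> p < 1 \<and> snd p > 0"
  by (cases p) (simp add: Omega_h_def power2_eq_square)

lemma Omega_h_subset_cball: "Omega_h \<subseteq> cball 0 1"
proof
  fix p assume "p \<in> Omega_h"
  then have "(norm p)\<^sup>2 \<le> 1\<^sup>2" by (simp add: Omega_h_iff power2_norm_eq_inner)
  then show "p \<in> cball 0 1" by (simp only: mem_cball_0) (rule power2_le_imp_le, auto)
qed

lemma bounded_Omega_h: "bounded Omega_h"
  using bounded_subset[OF bounded_cball Omega_h_subset_cball] .

lemma open_Omega_h: "open Omega_h"
proof -
  have "Omega_h = {p. p \<bullet> p < 1} \<inter> {p. 0 < snd p}" using Omega_h_iff by auto
  moreover have "open {p::real \<times> real. p \<bullet> p < 1}" "open {p::real \<times> real. 0 < snd p}"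
    by (auto intro!: open_Collect_less continuous_intros)
  ultimately show ?thesis using open_Int by metis
qed

lemma Omega_h_lebesgue: "Omega_h \<in> sets lebesgue"
  using open_Omega_h by auto

lemma finite_measure_Omega_h: "finite_measure (lebesgue_on Omega_h)"
  by (intro finite_measure_lebesgue_on bounded_set_imp_lmeasurable bounded_Omega_h Omega_h_lebesgue)

lemmas L2_continuous_Omega_h = L2_continuous[OF bounded_Omega_h Omega_h_lebesgue]

lemma L2_integrable_Omega_h: "L2 (lebesgue_on Omega_h) f \<Longrightarrow> integrable (lebesgue_on Omega_h) f"
  for f :: "real \<times> real \<Rightarrow> 'b::euclidean_space"
  by (rule finite_measure.L2_integrable[OF finite_measure_Omega_h])

text \<open>Squaring removes the kink of the positive part. This is the only building block of the
  cutoff, and it gives exactly the C1 regularity that test functions must have.\<close>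

lemma DERIV_max_0_squared: "((\<lambda>t::real. (max 0 t)\<^sup>2) has_real_derivative 2 * max 0 t) (at t)"
proof -
  consider "t < 0" | "t = 0" | "t > 0" by linarith
  then show ?thesis
  proof cases
    case 1
    have "((\<lambda>t::real. 0) has_real_derivative 0) (at t)" by simp
    then have "((\<lambda>t::real. (max 0 t)\<^sup>2) has_real_derivative 0) (at t)"
      by (rule has_field_derivative_transform_within_open[of _ _ _ "{..<0}"]) (use 1 in auto)
    then show ?thesis using 1 by simp
  next
    case 2
    have "((\<lambda>h::real. max 0 h) \<longlongrightarrow> max 0 0) (at 0)" by (intro tendsto_intros)
    moreover have "(\<lambda>h::real. max 0 h) = (\<lambda>h. ((max 0 (0 + h))\<^sup>2 - (max 0 0)\<^sup>2) / h)"
      by (auto simp: fun_eq_iff max_def power2_eq_square)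
    ultimately have "((\<lambda>h::real. ((max 0 (0 + h))\<^sup>2 - (max 0 0)\<^sup>2) / h) \<longlongrightarrow> max 0 0) (at 0)"
      by (rule back_subst[of "\<lambda>f. (f \<longlongrightarrow> max 0 0) (at 0)"])
    then show ?thesis using 2 by (simp add: DERIV_def)
  next
    case 3
    have "((\<lambda>t::real. t\<^sup>2) has_real_derivative 2 * t) (at t)"
      by (auto intro!: derivative_eq_intros)
    then have "((\<lambda>t::real. (max 0 t)\<^sup>2) has_real_derivative 2 * t) (at t)"
      by (rule has_field_derivative_transform_within_open[of _ _ _ "{0<..}"]) (use 3 in auto)
    then show ?thesis using 3 by simp
  qed
qed

text \<open>A C1 transition from 0 on t \<le> 1 to 1 on t \<ge> 2: the inner square smooths the
  junction at 2, the outer one that at 1. The zero plateau ends at 1 rather than at 0, so that the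
  cutoff built from it has compact support inside the open half disc.\<close>

definition smooth_step :: "real \<Rightarrow> real" where
  "smooth_step t = (max 0 (1 - (max 0 (2 - t))\<^sup>2))\<^sup>2"

definition smooth_step_deriv :: "real \<Rightarrow> real" where
  "smooth_step_deriv t = 4 * max 0 (1 - (max 0 (2 - t))\<^sup>2) * max 0 (2 - t)"

lemma DERIV_smooth_step: "(smooth_step has_real_derivative smooth_step_deriv t) (at t)"
proof -
  have a: "((\<lambda>t. 2 - t) has_real_derivative -1) (at t)"
    by (auto intro!: derivative_eq_intros)
  have b: "((\<lambda>t. 1 - (max 0 (2 - t))\<^sup>2) has_real_derivative 2 * max 0 (2 - t)) (at t)"
    using DERIV_diff[OF DERIV_const DERIV_chain2[OF DERIV_max_0_squared a]] by simp
  show ?thesis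
    using DERIV_chain2[OF DERIV_max_0_squared b]
    unfolding smooth_step_def[abs_def] smooth_step_deriv_def by (simp add: mult.assoc)
qed

lemma continuous_smooth_step_deriv: "continuous_on UNIV smooth_step_deriv"
  unfolding smooth_step_deriv_def[abs_def] by (intro continuous_intros)

lemma smooth_step_range: "0 \<le> smooth_step t" "smooth_step t \<le> 1"
  unfolding smooth_step_def by (auto intro!: power_le_one)

lemma smooth_step_eq_0: "t \<le> 1 \<Longrightarrow> smooth_step t = 0"
  and smooth_step_deriv_eq_0': "t \<le> 1 \<Longrightarrow> smooth_step_deriv t = 0"
proof -
  assume "t \<le> 1"
  then have "1\<^sup>2 \<le> (max 0 (2 - t))\<^sup>2" by (intro power_mono) auto
  then have "max 0 (1 - (max 0 (2 - t))\<^sup>2) = 0" by simp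
  then show "smooth_step t = 0" "smooth_step_deriv t = 0"
    unfolding smooth_step_def smooth_step_deriv_def by simp_all
qed

lemma smooth_step_eq_1: "t \<ge> 2 \<Longrightarrow> smooth_step t = 1"
  unfolding smooth_step_def by simp

lemma smooth_step_deriv_eq_0: "t \<ge> 2 \<Longrightarrow> smooth_step_deriv t = 0"
  unfolding smooth_step_deriv_def by simp

lemma abs_smooth_step_deriv_le: "\<bar>smooth_step_deriv t\<bar> \<le> 4"
proof (cases "t \<le> 1")
  case True
  then show ?thesis by (simp add: smooth_step_deriv_eq_0')
next
  case False
  have "max 0 (1 - (max 0 (2 - t))\<^sup>2) * max 0 (2 - t) \<le> 1 * 1"
    using False by (intro mult_mono) auto
  then show ?thesis unfolding smooth_step_deriv_def by (simp add: abs_mult mult.assoc)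
qed

text \<open>The polynomials \<open>snd p\<close> and \<open>1 - p \<bullet> p\<close> vanish on the
  two pieces of the boundary and replace the distance to it. Multiplying two steps, instead of using
  the distance to the whole boundary, avoids any singularity on the set where both pieces are
  equally far away.\<close>

definition cutoff :: "real \<Rightarrow> real \<times> real \<Rightarrow> real" where
  "cutoff d p = smooth_step (snd p / d) * smooth_step ((1 - p \<bullet> p) / d)"

text \<open>The part of the half disc where the gradient of \<open>cutoff d\<close> may be nonzero;
  the factor 2 is the point from which \<open>smooth_step\<close> is constant.\<close>

definition boundary_strip :: "real \<Rightarrow> (real \<times> real) set" where
  "boundary_strip d = {p \<in> Omega_h. snd p < 2 * d \<or> p \<bullet> p > 1 - 2 * d}"

lemma GDERIV_snd_divide: "GDERIV (\<lambda>p::real \<times> real. snd p / d) p :> (0, 1 / d)"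
proof -
  have "(\<lambda>p::real \<times> real. snd p / d) = (\<lambda>p. p \<bullet> (0, 1 / d))" by (auto simp: fun_eq_iff)
  then show ?thesis unfolding gderiv_def by (auto intro!: derivative_eq_intros)
qed

lemma GDERIV_one_minus_inner: "GDERIV (\<lambda>p::real \<times> real. (1 - p \<bullet> p) / d) p :> (- (2 / d)) *\<^sub>R p"
proof -
  have "((\<lambda>p::real \<times> real. (1 - p \<bullet> p) * (1 / d)) has_derivative
      (\<lambda>h. (0 - (p \<bullet> h + h \<bullet> p)) * (1 / d))) (at p)"
    by (intro has_derivative_mult_left has_derivative_diff has_derivative_const
        has_derivative_inner has_derivative_ident)
  moreover have "(\<lambda>h. (0 - (p \<bullet> h + h \<bullet> p)) * (1 / d)) = (\<lambda>h. h \<bullet> ((- (2 / d)) *\<^sub>R p))"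
    by (auto simp: fun_eq_iff inner_commute)
  ultimately show ?thesis unfolding gderiv_def by simp
qed

lemma C1_snd_divide: "C1 (\<lambda>p::real \<times> real. snd p / d)"
  by (rule C1_I[OF GDERIV_snd_divide]) (intro continuous_intros)

lemma C1_one_minus_inner: "C1 (\<lambda>p::real \<times> real. (1 - p \<bullet> p) / d)"
  by (rule C1_I[OF GDERIV_one_minus_inner]) (intro continuous_intros)

lemma C1_cutoff: "C1 (cutoff d)"
  unfolding cutoff_def[abs_def]
  by (intro C1_mult C1_compose_real[OF C1_snd_divide DERIV_smooth_step continuous_smooth_step_deriv]
      C1_compose_real[OF C1_one_minus_inner DERIV_smooth_step continuous_smooth_step_deriv])

lemma grad_cutoff:
  "grad (cutoff d) p =
     smooth_step (snd p / d) *\<^sub>R smooth_step_deriv ((1 - p \<bullet> p) / d) *\<^sub>R (- (2 / d)) *\<^sub>R p +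
     smooth_step ((1 - p \<bullet> p) / d) *\<^sub>R smooth_step_deriv (snd p / d) *\<^sub>R (0, 1 / d)"
  unfolding cutoff_def[abs_def]
  by (rule grad_eqI[OF GDERIV_mult[OF
        GDERIV_DERIV_compose[OF GDERIV_snd_divide DERIV_smooth_step]
        GDERIV_DERIV_compose[OF GDERIV_one_minus_inner DERIV_smooth_step]]])

lemma grad_cutoff_outside_strip:
  assumes "d > 0" "p \<in> Omega_h" "p \<notin> boundary_strip d"
  shows "grad (cutoff d) p = 0"
proof -
  have "snd p \<ge> 2 * d" "1 - p \<bullet> p \<ge> 2 * d" using assms by (auto simp: boundary_strip_def)
  then have "snd p / d \<ge> 2" "(1 - p \<bullet> p) / d \<ge> 2" using assms(1) by (simp_all add: pos_le_divide_eq)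
  then show ?thesis by (simp add: grad_cutoff smooth_step_deriv_eq_0 zero_prod_def[symmetric])
qed

text \<open>The derivative of the step is at most 4, and on the half disc its two arguments have
  gradients of length at most 2/d and 1/d; this gives 8/d + 4/d.\<close>

lemma norm_grad_cutoff_le:
  assumes d: "d > 0" and p: "p \<in> Omega_h"
  shows "norm (grad (cutoff d) p) \<le> 12 / d"
proof -
  have np: "norm p \<le> 1" using p Omega_h_subset_cball by auto
  have "norm (smooth_step (snd p / d) *\<^sub>R smooth_step_deriv ((1 - p \<bullet> p) / d) *\<^sub>R (- (2 / d)) *\<^sub>R p)
      = smooth_step (snd p / d) * (\<bar>smooth_step_deriv ((1 - p \<bullet> p) / d)\<bar> * ((2 / d) * norm p))"
    using d smooth_step_range by (simp add: abs_mult)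
  also have "\<dots> \<le> 1 * (4 * ((2 / d) * 1))"
    using d np smooth_step_range abs_smooth_step_deriv_le
    by (intro mult_mono mult_nonneg_nonneg) auto
  finally have 1: "norm (smooth_step (snd p / d) *\<^sub>R smooth_step_deriv ((1 - p \<bullet> p) / d) *\<^sub>R (- (2 / d)) *\<^sub>R p)
    \<le> 8 / d" by simp
  have "norm (smooth_step ((1 - p \<bullet> p) / d) *\<^sub>R smooth_step_deriv (snd p / d) *\<^sub>R (0::real, 1 / d))
      = smooth_step ((1 - p \<bullet> p) / d) * (\<bar>smooth_step_deriv (snd p / d)\<bar> * (1 / d))"
    using d smooth_step_range by (simp add: norm_Pair abs_mult)
  also have "\<dots> \<le> 1 * (4 * (1 / d))"
    using d smooth_step_range abs_smooth_step_deriv_le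
    by (intro mult_mono mult_nonneg_nonneg) auto
  finally have 2: "norm (smooth_step ((1 - p \<bullet> p) / d) *\<^sub>R smooth_step_deriv (snd p / d) *\<^sub>R (0::real, 1 / d))
    \<le> 4 / d" by simp
  have "8 / d + 4 / d = 12 / d" by (simp add: add_divide_distrib[symmetric])
  then show ?thesis
    unfolding grad_cutoff using norm_triangle_mono[OF 1 2] by simp
qed

lemma cutoff_range: "0 \<le> cutoff d p" "cutoff d p \<le> 1"
  unfolding cutoff_def using smooth_step_range by (auto intro!: mult_le_one)

lemma C1_0_cutoff:
  assumes d: "d > 0"
  shows "C1_0 Omega_h (cutoff d)"
  unfolding C1_0_def
proof (intro conjI exI[of _ "{p::real \<times> real. d \<le> snd p} \<inter> {p. p \<bullet> p \<le> 1 - d}"] allI impI)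
  show "C1 (cutoff d)" by (rule C1_cutoff)
  have "{p::real \<times> real. d \<le> snd p} \<inter> {p. p \<bullet> p \<le> 1 - d} \<subseteq> Omega_h" using d by (auto simp: Omega_h_iff)
  then show "{p::real \<times> real. d \<le> snd p} \<inter> {p. p \<bullet> p \<le> 1 - d} \<subseteq> Omega_h" .
  then have "bounded ({p::real \<times> real. d \<le> snd p} \<inter> {p. p \<bullet> p \<le> 1 - d})"
    by (rule bounded_subset[OF bounded_Omega_h])
  moreover have "closed ({p::real \<times> real. d \<le> snd p} \<inter> {p. p \<bullet> p \<le> 1 - d})"
    by (intro closed_Int closed_Collect_le continuous_intros)
  ultimately show "compact ({p::real \<times> real. d \<le> snd p} \<inter> {p. p \<bullet> p \<le> 1 - d})"
    by (simp add: compact_eq_bounded_closed)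
  fix p assume "p \<notin> {p::real \<times> real. d \<le> snd p} \<inter> {p. p \<bullet> p \<le> 1 - d}"
  then consider "snd p / d \<le> 1" | "(1 - p \<bullet> p) / d \<le> 1"
    using d by (auto simp: pos_divide_le_eq)
  then show "cutoff d p = 0" by cases (simp_all add: cutoff_def smooth_step_eq_0)
qed

lemma cutoff_eventually_1:
  assumes p: "p \<in> Omega_h"
  shows "eventually (\<lambda>d. cutoff d p = 1 \<and> p \<notin> boundary_strip d) (at_right 0)"
proof -
  define m where "m = min (snd p) (1 - p \<bullet> p) / 2"
  have m: "0 < m" using p unfolding m_def Omega_h_iff by simp
  have ev: "eventually (\<lambda>d. d \<in> {0<..<m}) (at_right 0)" by (rule eventually_at_right_real[OF m])
  show ?thesis
  proof (rule eventually_mono[OF ev])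
    fix d assume "d \<in> {0<..<m}"
    then have d: "0 < d" "d < m" by auto
    then have 1: "2 * d \<le> snd p" "2 * d \<le> 1 - p \<bullet> p" unfolding m_def by auto
    then have "snd p / d \<ge> 2" "(1 - p \<bullet> p) / d \<ge> 2" using d(1) by (simp_all add: pos_le_divide_eq)
    then show "cutoff d p = 1 \<and> p \<notin> boundary_strip d"
      using 1 by (simp add: cutoff_def smooth_step_eq_1 boundary_strip_def)
  qed
qed

lemma filterlim_inverse_Suc_at_right_0: "filterlim (\<lambda>n. 1 / real (Suc n)) (at_right 0) sequentially"
  unfolding filterlim_at
proof
  show "(\<lambda>n. 1 / real (Suc n)) \<longlonglongrightarrow> 0" by (rule LIMSEQ_Suc[OF lim_1_over_n])
qed (simp add: always_eventually)

section \<open>Uniqueness of weak gradients\<close>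

lemma function_ring_C1:
  fixes K :: "'a::euclidean_space set"
  assumes "compact K"
  shows "function_ring_on {q :: 'a \<Rightarrow> real. C1 q} K"
proof
  show "compact K" by fact
  show "\<exists>f\<in>{q. C1 q}. f x \<noteq> f y" if "x \<noteq> y" for x y :: 'a
  proof
    show "x \<bullet> (x - y) \<noteq> y \<bullet> (x - y)"
      using that inner_eq_zero_iff[of "x - y"] by (auto simp: inner_diff_left)
  qed (simp add: C1_inner)
qed (auto simp: C1_continuous C1_add C1_mult C1_const)

text \<open>Test functions form no ring with constants, so Stone-Weierstrass cannot be applied to
  them directly. Instead the cutoff is absorbed into the field: \<open>cutoff d\<close> times a C1
  function is a test function, hence each component of the difference times \<open>cutoff d\<close>
  is orthogonal to all C1 functions, which do form such a ring.\<close>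

lemma weak_gradient_unique:
  assumes U: "has_weak_gradient Omega_h u U" and U': "has_weak_gradient Omega_h u U'"
  shows "AE x in lebesgue_on Omega_h. U x = U' x"
proof -
  have L2U: "L2 (lebesgue_on Omega_h) U" "L2 (lebesgue_on Omega_h) U'"
    using U U' by (simp_all add: has_weak_gradient_def)
  note iU = L2U[THEN L2_integrable_Omega_h]
  have 1: "AE x in lebesgue_on Omega_h. ((U x - U' x) \<bullet> e) * cutoff d x = 0"
    if d: "d > 0" for d e
  proof (rule AE_eq_0_of_function_ring[OF function_ring_C1[OF compact_cball] Omega_h_subset_cball Omega_h_lebesgue])
    show "integrable (lebesgue_on Omega_h) (\<lambda>x. (U x - U' x) \<bullet> e * cutoff d x)"
      using iU
      by (intro integrable_mult_continuous[OF _ Omega_h_lebesgue Omega_h_subset_cball compact_cball]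
           C1_continuous C1_cutoff) auto
    fix q :: "real \<times> real \<Rightarrow> real" assume "q \<in> {q. C1 q}"
    then have q: "C1 q" by simp
    define p where "p x = cutoff d x * q x" for x
    have p: "C1_0 Omega_h p" unfolding p_def by (rule C1_0_mult[OF C1_0_cutoff[OF d] q])
    have cp: "continuous_on UNIV p" using p C1_continuous unfolding C1_0_def by blast
    have ip: "integrable (lebesgue_on Omega_h) (\<lambda>x. p x *\<^sub>R V x)"
      if V: "L2 (lebesgue_on Omega_h) V" for V :: "real \<times> real \<Rightarrow> real \<times> real"
    proof -
      obtain B where B: "\<And>x. x \<in> cball 0 1 \<Longrightarrow> \<bar>p x\<bar> \<le> B"
        using continuous_on_compact_abs_bound[OF compact_cball continuous_on_subset[OF cp subset_UNIV]] by blast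
      have pm: "p \<in> borel_measurable (lebesgue_on Omega_h)"
        by (rule continuous_imp_measurable_on_sets_lebesgue[OF continuous_on_subset[OF cp subset_UNIV] Omega_h_lebesgue])
      show ?thesis
        by (rule L2_integrable_Omega_h[OF L2_scaleR_bounded[OF V pm, of B]])
           (use B Omega_h_subset_cball in auto)
    qed
    note ipU = L2U[THEN ip]
    have "(LINT x|lebesgue_on Omega_h. p x *\<^sub>R U x) = (LINT x|lebesgue_on Omega_h. p x *\<^sub>R U' x)"
    proof -
      have "- (LINT x|lebesgue_on Omega_h. p x *\<^sub>R U x) = - (LINT x|lebesgue_on Omega_h. p x *\<^sub>R U' x)"
        using U U' p unfolding has_weak_gradient_def by simp
      then show ?thesis by (simp only: neg_equal_iff_equal)
    qed
    then have "(LINT x|lebesgue_on Omega_h. p x *\<^sub>R U x - p x *\<^sub>R U' x) = 0"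
      using ipU by simp
    then have "(LINT x|lebesgue_on Omega_h. (p x *\<^sub>R U x - p x *\<^sub>R U' x) \<bullet> e) = 0"
      using ipU by simp
    then show "(LINT x|lebesgue_on Omega_h. (U x - U' x) \<bullet> e * cutoff d x * q x) = 0"
      by (simp add: p_def inner_diff_left algebra_simps)
  qed
  \<comment> \<open>With countably many cutoffs and finitely many components the exceptional set
    stays null, and at each point of the half disc one of these cutoffs equals 1.\<close>
  have "AE x in lebesgue_on Omega_h. \<forall>n::nat. \<forall>e\<in>Basis. ((U x - U' x) \<bullet> e) * cutoff (1 / Suc n) x = 0"
    unfolding AE_all_countable
  proof
    fix n :: nat
    show "AE x in lebesgue_on Omega_h. \<forall>e\<in>Basis. ((U x - U' x) \<bullet> e) * cutoff (1 / Suc n) x = 0"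
      by (rule AE_finite_allI[OF finite_Basis]) (rule 1, simp)
  qed
  then show ?thesis
  proof (rule AE_mp, intro AE_I2 impI)
    fix x assume x: "x \<in> space (lebesgue_on Omega_h)"
      and *: "\<forall>n::nat. \<forall>e\<in>Basis. ((U x - U' x) \<bullet> e) * cutoff (1 / Suc n) x = 0"
    have "eventually (\<lambda>n. cutoff (1 / real (Suc n)) x = 1) sequentially"
      using eventually_compose_filterlim[OF cutoff_eventually_1 filterlim_inverse_Suc_at_right_0, of x] x
      by (simp add: eventually_conj_iff)
    then obtain n where "cutoff (1 / real (Suc n)) x = 1"
      using eventually_happens'[OF sequentially_bot] by blast
    then have "\<forall>e\<in>Basis. (U x - U' x) \<bullet> e = 0" using * by force
    then have "U x - U' x = 0" using euclidean_all_zero_iff by blast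
    then show "U x = U' x" by simp
  qed
qed

lemma weak_grad_AE_eq:
  assumes "has_weak_gradient Omega_h u U"
  shows "AE x in lebesgue_on Omega_h. weak_grad Omega_h u x = U x"
  unfolding weak_grad_def
  by (rule weak_gradient_unique[OF someI[of "has_weak_gradient Omega_h u", OF assms] assms])

section \<open>The harmonic functions Im z^n\<close>

definition re_pow :: "nat \<Rightarrow> real \<times> real \<Rightarrow> real" where
  "re_pow n p = Re (Complex (fst p) (snd p) ^ n)"

definition im_pow :: "nat \<Rightarrow> real \<times> real \<Rightarrow> real" where
  "im_pow n p = Im (Complex (fst p) (snd p) ^ n)"

text \<open>The Cauchy-Riemann equations are contained in the form of this real differential: it is
  multiplication by a complex number. For n = 0 the truncated exponent n - 1 is harmless because of
  the factor n.\<close>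

lemma has_derivative_complex_pow:
  "((\<lambda>p. Complex (fst p) (snd p) ^ n) has_derivative
     (\<lambda>h. of_nat n * Complex (fst p) (snd p) ^ (n - 1) * Complex (fst h) (snd h))) (at p)"
proof -
  have C: "((\<lambda>p. Complex (fst p) (snd p)) has_derivative (\<lambda>h. Complex (fst h) (snd h))) (at p)"
    unfolding Complex_eq
    by (intro has_derivative_add has_derivative_mult_right has_derivative_of_real
        has_derivative_fst has_derivative_snd has_derivative_ident)
  show ?thesis
    by (rule has_derivative_eq_rhs[OF has_derivative_power[OF C]]) (simp add: mult_ac fun_eq_iff)
qed

lemma GDERIV_re_pow:
  "GDERIV (re_pow n) p :> real n *\<^sub>R (re_pow (n - 1) p, - im_pow (n - 1) p)"
  unfolding gderiv_def re_pow_def[abs_def] im_pow_def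
  by (rule has_derivative_eq_rhs[OF has_derivative_Re[OF has_derivative_complex_pow]])
     (auto simp: fun_eq_iff algebra_simps inner_prod_def)

lemma GDERIV_im_pow:
  "GDERIV (im_pow n) p :> real n *\<^sub>R (im_pow (n - 1) p, re_pow (n - 1) p)"
  unfolding gderiv_def re_pow_def im_pow_def[abs_def]
  by (rule has_derivative_eq_rhs[OF has_derivative_Im[OF has_derivative_complex_pow]])
     (auto simp: fun_eq_iff algebra_simps inner_prod_def)

lemma continuous_re_pow: "continuous_on S (re_pow n)"
  using GDERIV_re_pow unfolding gderiv_def
  by (meson continuous_at_imp_continuous_on has_derivative_continuous)

lemma continuous_im_pow: "continuous_on S (im_pow n)"
  using GDERIV_im_pow unfolding gderiv_def
  by (meson continuous_at_imp_continuous_on has_derivative_continuous)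

lemma C1_re_pow: "C1 (re_pow n)"
  by (rule C1_I[OF GDERIV_re_pow]) (intro continuous_intros continuous_re_pow continuous_im_pow)

lemma C1_im_pow: "C1 (im_pow n)"
  by (rule C1_I[OF GDERIV_im_pow]) (intro continuous_intros continuous_re_pow continuous_im_pow)

lemma grad_re_pow: "grad (re_pow n) p = real n *\<^sub>R (re_pow (n - 1) p, - im_pow (n - 1) p)"
  by (rule grad_eqI[OF GDERIV_re_pow])

lemma grad_im_pow: "grad (im_pow n) p = real n *\<^sub>R (im_pow (n - 1) p, re_pow (n - 1) p)"
  by (rule grad_eqI[OF GDERIV_im_pow])

text \<open>As a complex number, the gradient of Im z^n is i n cnj (z^(n-1)), and the Euclidean
  inner product of a and b is Re (a cnj b); the factors i cancel.\<close>

lemma grad_im_pow_inner: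
  "grad (im_pow n) p \<bullet> grad (im_pow k) p =
     real n * real k * Re (Complex (fst p) (snd p) ^ (n - 1) * cnj (Complex (fst p) (snd p)) ^ (k - 1))"
  by (simp add: grad_im_pow re_pow_def im_pow_def algebra_simps flip: complex_cnj_power)

lemma im_pow_bdry:
  assumes "s \<in> {0..<pi + 2}" "n \<ge> 1"
  shows "im_pow n (bdry s) = ext0 (\<lambda>\<phi>. sin (real n * \<phi>)) s"
proof (cases "s \<le> pi")
  case True
  have "Complex (cos s) (sin s) ^ n = cis (real n * s)"
  proof -
    have "Complex (cos s) (sin s) = cis s" by (simp add: cis.code)
    then show ?thesis by (simp only: Complex.DeMoivre)
  qed
  then have "im_pow n (bdry s) = sin (real n * s)"
    using True by (simp add: im_pow_def bdry_def)
  \<comment> \<open>At the two corners \<open>ext0\<close> takes its default value 0, which agrees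
    with the sine there.\<close>
  moreover have "sin (real n * s) = 0" if "s = 0 \<or> s = pi" using that by auto
  ultimately show ?thesis using True assms(1) unfolding ext0_def by force
next
  case False
  have "Complex (s - pi - 1) 0 ^ n = of_real ((s - pi - 1) ^ n)"
    by (simp add: Complex_eq)
  then show ?thesis using False by (simp add: im_pow_def bdry_def ext0_def)
qed

text \<open>Each component is integrated by parts, and the divergence appears against
  \<open>p\<close>. It is applied to the field (Im z^(n-1), Re z^(n-1)), which is divergence free by
  Cauchy-Riemann; thus harmonicity of Im z^n is obtained from first derivatives alone.\<close>

lemma integral_divergence_free_inner_grad:
  assumes a: "C1 a" and b: "C1 b"
    and div: "\<And>x. fst (grad a x) + snd (grad b x) = 0" and p: "C1_0 Omega_h p"
  shows "(LINT x|lebesgue_on Omega_h. (a x, b x) \<bullet> grad p x) = 0"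
proof -
  have p1: "C1 p" using p by (simp add: C1_0_def)
  have i: "integrable (lebesgue_on Omega_h) (\<lambda>x. u x *\<^sub>R grad v x)" if "C1 u" "C1 v"
    for u v :: "real \<times> real \<Rightarrow> real"
    by (intro L2_integrable_Omega_h L2_continuous_Omega_h continuous_on_scaleR
        C1_continuous C1_continuous_grad that)
  have "(LINT x|lebesgue_on Omega_h. (a x, b x) \<bullet> grad p x)
      = (LINT x|lebesgue_on Omega_h. (a x *\<^sub>R grad p x) \<bullet> (1, 0) + (b x *\<^sub>R grad p x) \<bullet> (0, 1))"
    by (rule Bochner_Integration.integral_cong) (auto simp: inner_prod_def)
  also have "\<dots> = (LINT x|lebesgue_on Omega_h. a x *\<^sub>R grad p x) \<bullet> (1, 0)
      + (LINT x|lebesgue_on Omega_h. b x *\<^sub>R grad p x) \<bullet> (0, 1)"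
    using i[OF a p1] i[OF b p1]
    by (simp only: Bochner_Integration.integral_add integral_inner_left integrable_inner_left)
  also have "\<dots> = - ((LINT x|lebesgue_on Omega_h. p x *\<^sub>R grad a x) \<bullet> (1, 0)
      + (LINT x|lebesgue_on Omega_h. p x *\<^sub>R grad b x) \<bullet> (0, 1))"
    by (simp only: integral_by_parts_C1_0[OF a p open_Omega_h]
        integral_by_parts_C1_0[OF b p open_Omega_h] inner_minus_left minus_add_distrib)
  also have "\<dots> = - (LINT x|lebesgue_on Omega_h. (p x *\<^sub>R grad a x) \<bullet> (1, 0) + (p x *\<^sub>R grad b x) \<bullet> (0, 1))"
    using i[OF p1 a] i[OF p1 b]
    by (simp only: Bochner_Integration.integral_add integral_inner_left integrable_inner_left)
  also have "(\<lambda>x. (p x *\<^sub>R grad a x) \<bullet> (1, 0) + (p x *\<^sub>R grad b x) \<bullet> (0, 1)) = (\<lambda>x. 0)"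
    using div by (simp add: inner_prod_def fun_eq_iff flip: distrib_left)
  finally show ?thesis by simp
qed

lemma integral_grad_im_pow_inner_grad:
  assumes "C1_0 Omega_h p"
  shows "(LINT x|lebesgue_on Omega_h. grad (im_pow n) x \<bullet> grad p x) = 0"
proof -
  have "(LINT x|lebesgue_on Omega_h. (im_pow (n - 1) x, re_pow (n - 1) x) \<bullet> grad p x) = 0"
    by (rule integral_divergence_free_inner_grad[OF C1_im_pow C1_re_pow _ assms])
       (simp add: grad_im_pow grad_re_pow)
  then show ?thesis
    by (simp only: grad_im_pow inner_scaleR_left integral_mult_right_zero mult_zero_right)
qed

lemma has_weak_gradient_im_pow: "has_weak_gradient Omega_h (im_pow n) (grad (im_pow n))"
  by (rule has_weak_gradient_C1[OF C1_im_pow open_Omega_h bounded_Omega_h])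

lemma weak_grad_im_pow: "AE x in lebesgue_on Omega_h. weak_grad Omega_h (im_pow n) x = grad (im_pow n) x"
  by (rule weak_grad_AE_eq[OF has_weak_gradient_im_pow])

lemma has_weak_gradient_weak_grad:
  "u \<in> H1 Om \<Longrightarrow> has_weak_gradient Om u (weak_grad Om u)"
  using someI_ex[of "has_weak_gradient Om u"] by (simp add: H1_def weak_grad_def)

lemma im_pow_H1: "im_pow n \<in> H1 Omega_h"
  unfolding H1_def using has_weak_gradient_im_pow by blast

lemma weakly_harmonic_im_pow: "weakly_harmonic Omega_h (im_pow n)"
  unfolding weakly_harmonic_def
proof (intro conjI allI impI)
  show "im_pow n \<in> H1 Omega_h" by (rule im_pow_H1)
  fix p assume p: "C1_0 Omega_h p"
  then have "C1 p" by (simp add: C1_0_def)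
  then have m: "grad p \<in> borel_measurable (lebesgue_on Omega_h)"
    "grad (im_pow n) \<in> borel_measurable (lebesgue_on Omega_h)"
    by (auto intro!: continuous_imp_measurable_on_sets_lebesgue C1_continuous_grad Omega_h_lebesgue C1_im_pow)
  have m': "weak_grad Omega_h (im_pow n) \<in> borel_measurable (lebesgue_on Omega_h)"
    using has_weak_gradient_weak_grad[OF im_pow_H1] by (simp add: has_weak_gradient_def L2_def)
  have "(LINT x|lebesgue_on Omega_h. weak_grad Omega_h (im_pow n) x \<bullet> grad p x)
      = (LINT x|lebesgue_on Omega_h. grad (im_pow n) x \<bullet> grad p x)"
    by (rule integral_cong_AE) (use m m' weak_grad_im_pow[of n] in \<open>auto elim: AE_mp\<close>)
  then show "(LINT x|lebesgue_on Omega_h. weak_grad Omega_h (im_pow n) x \<bullet> grad p x) = 0"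
    using integral_grad_im_pow_inner_grad[OF p] by simp
qed

section \<open>Boundary values of Im z^n\<close>

lemma L2_ext0_sin: "L2 bdry_measure (ext0 (\<lambda>\<phi>. sin (real n * \<phi>)))"
proof -
  have S: "L2 bdry_measure (\<lambda>\<phi>. sin (real n * \<phi>))"
    unfolding bdry_measure_def by (rule L2_continuous) (auto intro!: continuous_intros)
  have "L2 bdry_measure (\<lambda>\<phi>. indicator {0<..<pi} \<phi> *\<^sub>R sin (real n * \<phi>))"
  proof (rule L2_scaleR_bounded[OF S, of _ 1])
    show "indicator {0<..<pi} \<in> borel_measurable bdry_measure"
      unfolding bdry_measure_def
      by (intro measurable_restrict_space1 measurable_completion borel_measurable_indicator) simp
  qed (auto simp: indicator_def)
  moreover have "(\<lambda>\<phi>. indicator {0<..<pi} \<phi> *\<^sub>R sin (real n * \<phi>)) = ext0 (\<lambda>\<phi>. sin (real n * \<phi>))"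
    by (auto simp: fun_eq_iff ext0_def)
  ultimately show ?thesis by simp
qed

lemma space_bdry_measure: "space bdry_measure = {0..<pi + 2}"
  by (simp add: bdry_measure_def)

lemma emeasure_bdry_measure_finite: "emeasure bdry_measure (space bdry_measure) < \<infinity>"
proof -
  have "finite_measure bdry_measure"
    unfolding bdry_measure_def
    by (intro finite_measure_lebesgue_on bounded_set_imp_lmeasurable) auto
  then show ?thesis using finite_measure.emeasure_finite[of bdry_measure] by (simp add: less_top)
qed

lemma norm_bdry: "s \<in> {0..<pi + 2} \<Longrightarrow> norm (bdry s) \<le> 1"
  by (auto simp: bdry_def norm_Pair)

text \<open>On the boundary the datum is the restriction of a Lipschitz function of the plane.\<close>
lemma H_half_ext0_sin:
  assumes "n \<ge> 1"
  shows "H_half (ext0 (\<lambda>\<phi>. sin (real n * \<phi>)))"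
  unfolding H_half_def
proof
  let ?h = "ext0 (\<lambda>\<phi>. sin (real n * \<phi>))"
  show "L2 bdry_measure ?h" by (rule L2_ext0_sin)
  obtain B where B: "B \<ge> 0"
      "\<And>x y. x \<in> cball 0 1 \<Longrightarrow> y \<in> cball 0 1 \<Longrightarrow> \<bar>im_pow n x - im_pow n y\<bar> \<le> B * dist x y"
    by (rule C1_Lipschitz_compact_convex[OF C1_im_pow compact_cball convex_cball, of 0 1]) blast
  have le: "(?h s - ?h t)\<^sup>2 / (dist (bdry s) (bdry t))\<^sup>2 \<le> B\<^sup>2"
    if "s \<in> {0..<pi + 2}" "t \<in> {0..<pi + 2}" for s t
  \<comment> \<open>Where the two boundary points coincide, the quotient is 0 by the convention on
    division by zero.\<close>
  proof (cases "bdry s = bdry t")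
    case False
    have "\<bar>?h s - ?h t\<bar> \<le> B * dist (bdry s) (bdry t)"
      using B(2)[of "bdry s" "bdry t"] norm_bdry that im_pow_bdry[OF _ assms] by simp
    then have "\<bar>?h s - ?h t\<bar>\<^sup>2 \<le> (B * dist (bdry s) (bdry t))\<^sup>2" by (intro power_mono) auto
    then show ?thesis using False by (simp add: pos_divide_le_eq power_mult_distrib)
  qed simp
  have "(\<integral>\<^sup>+ s. \<integral>\<^sup>+ t. ennreal ((?h s - ?h t)\<^sup>2 / (dist (bdry s) (bdry t))\<^sup>2) \<partial>bdry_measure \<partial>bdry_measure)
      \<le> (\<integral>\<^sup>+ s. \<integral>\<^sup>+ t. ennreal (B\<^sup>2) \<partial>bdry_measure \<partial>bdry_measure)"
    using le by (intro nn_integral_mono) (auto simp: space_bdry_measure intro!: ennreal_leI)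
  also have "\<dots> < \<infinity>"
    using emeasure_bdry_measure_finite by (simp add: ennreal_mult_less_top)
  finally show "(\<integral>\<^sup>+ s. \<integral>\<^sup>+ t. ennreal ((?h s - ?h t)\<^sup>2 / (dist (bdry s) (bdry t))\<^sup>2) \<partial>bdry_measure \<partial>bdry_measure) < \<infinity>" .
qed

text \<open>The function is C1 on the whole plane, so the constant sequence approximates it; only
  the gradient needs an almost everywhere argument, since \<open>weak_grad\<close> is a
  choice.\<close>

lemma has_trace_im_pow:
  assumes "n \<ge> 1"
  shows "has_trace (im_pow n) (ext0 (\<lambda>\<phi>. sin (real n * \<phi>)))"
  unfolding has_trace_def
proof (intro conjI exI[of _ "\<lambda>i. im_pow n"] allI)
  show "im_pow n \<in> H1 Omega_h" by (rule im_pow_H1)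
  show "L2 bdry_measure (ext0 (\<lambda>\<phi>. sin (real n * \<phi>)))" by (rule L2_ext0_sin)
  show "C1 (im_pow n)" by (rule C1_im_pow)
  have "(LINT x|lebesgue_on Omega_h. (norm (grad (im_pow n) x - weak_grad Omega_h (im_pow n) x))\<^sup>2) = 0"
    by (rule integral_eq_zero_AE) (use weak_grad_im_pow[of n] in \<open>auto elim: AE_mp\<close>)
  then show "(\<lambda>i. LINT x|lebesgue_on Omega_h. (norm (grad (im_pow n) x - weak_grad Omega_h (im_pow n) x))\<^sup>2)
          \<longlonglongrightarrow> 0" by simp
  have "(LINT s|bdry_measure. (im_pow n (bdry s) - ext0 (\<lambda>\<phi>. sin (real n * \<phi>)) s)\<^sup>2) = 0"
    by (rule integral_eq_zero_AE) (auto simp: im_pow_bdry[OF _ assms] space_bdry_measure intro!: AE_I2)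
  then show "(\<lambda>i. LINT s|bdry_measure. (im_pow n (bdry s) - ext0 (\<lambda>\<phi>. sin (real n * \<phi>)) s)\<^sup>2) \<longlonglongrightarrow> 0"
    by simp
qed simp

section \<open>Functions near the boundary\<close>

text \<open>The definitions use the completed measure, while slicing needs \<open>lborel\<close>,
  which is the product of its one-dimensional versions. For Borel integrands one can pass between
  the two.\<close>

lemma nn_integral_lebesgue_on:
  fixes f :: "'a::euclidean_space \<Rightarrow> ennreal"
  assumes "f \<in> borel_measurable borel" "S \<in> sets lebesgue"
  shows "(\<integral>\<^sup>+ x. f x \<partial>lebesgue_on S) = (\<integral>\<^sup>+ x. f x * indicator S x \<partial>lborel)"
  using assms(2) by (simp add: nn_integral_restrict_space nn_integral_completion)

lemma ennreal_integral_lebesgue_on: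
  fixes f :: "'a::euclidean_space \<Rightarrow> real"
  assumes "integrable (lebesgue_on S) f" "f \<in> borel_measurable borel" "S \<in> sets lebesgue" "\<And>x. f x \<ge> 0"
  shows "ennreal (LINT x|lebesgue_on S. f x) = (\<integral>\<^sup>+ x. ennreal (f x) * indicator S x \<partial>lborel)"
  using nn_integral_eq_integral[OF assms(1)] nn_integral_lebesgue_on[of "\<lambda>x. ennreal (f x)" S] assms
  by simp

text \<open>The fundamental theorem of calculus, followed by Cauchy-Schwarz against the constant 1.
  Extended nonnegative integrals are used so that the bound can be integrated by Tonelli's
  theorem.\<close>

lemma diff_squared_le_integral_deriv_squared:
  fixes g g' :: "real \<Rightarrow> real"
  assumes g: "\<And>t. (g has_real_derivative g' t) (at t)" and g': "continuous_on UNIV g'" and ab: "a \<le> b"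
  shows "ennreal ((g b - g a)\<^sup>2) \<le> ennreal (b - a) * (\<integral>\<^sup>+ s. ennreal ((g' s)\<^sup>2) * indicator {a<..<b} s \<partial>lborel)"
proof -
  let ?M = "lebesgue_on {a<..<b}"
  have L: "L2 ?M g'" "L2 ?M (\<lambda>s. 1::real)" by (auto intro!: L2_continuous g')
  have ig: "integrable ?M g'" by (rule integrable_lebesgue_on_continuous[OF _ _ g']) auto
  have "(g' has_integral (g b - g a)) {a..b}"
    using g ab
    by (intro fundamental_theorem_of_calculus)
       (auto simp: has_real_derivative_iff_has_vector_derivative intro: has_vector_derivative_at_within)
  then have "(LINT s|?M. g' s) = g b - g a"
    using ig by (simp add: lebesgue_integral_eq_integral has_integral_Icc_iff_Ioo integral_unique)
  moreover have "\<bar>LINT s|?M. g' s \<bullet> 1\<bar> \<le> sqrt (LINT s|?M. (norm (g' s))\<^sup>2) * sqrt (LINT s|?M. (norm (1::real))\<^sup>2)"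
    by (rule L2_Cauchy_Schwarz[OF L])
  moreover have "(LINT s|?M. (norm (1::real))\<^sup>2) = b - a"
    using ab by (simp add: measure_restrict_space)
  ultimately have "\<bar>g b - g a\<bar> \<le> sqrt (LINT s|?M. (g' s)\<^sup>2) * sqrt (b - a)" by simp
  then have "\<bar>g b - g a\<bar>\<^sup>2 \<le> (sqrt (LINT s|?M. (g' s)\<^sup>2) * sqrt (b - a))\<^sup>2"
    by (rule power_mono) simp
  also have "\<dots> = (b - a) * (LINT s|?M. (g' s)\<^sup>2)" using ab by (simp add: power_mult_distrib)
  finally have "ennreal ((g b - g a)\<^sup>2) \<le> ennreal ((b - a) * (LINT s|?M. (g' s)\<^sup>2))"
    by (simp add: ennreal_leI)
  also have "\<dots> = ennreal (b - a) * ennreal (LINT s|?M. (g' s)\<^sup>2)" using ab by (simp add: ennreal_mult)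
  also have "ennreal (LINT s|?M. (g' s)\<^sup>2) = (\<integral>\<^sup>+ s. ennreal ((g' s)\<^sup>2) * indicator {a<..<b} s \<partial>lborel)"
    by (rule ennreal_integral_lebesgue_on)
       (auto intro!: integrable_lebesgue_on_continuous continuous_intros g' borel_measurable_continuous_onI)
  finally show ?thesis .
qed

text \<open>A one-dimensional Poincare inequality with base point \<open>c\<close>: bound the square
  of g t by twice the square of g c plus twice that of the increment, then integrate over an
  interval of length 2h. In the application \<open>c\<close> lies on the boundary, outside the open
  domain, which is why only the open segment between \<open>t\<close> and \<open>c\<close> has to
  lie in \<open>B\<close>.\<close>

lemma nn_integral_slice_le:
  fixes g g' :: "real \<Rightarrow> real"
  assumes g: "\<And>t. (g has_real_derivative g' t) (at t)" and g': "continuous_on UNIV g'"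
    and A: "A \<in> sets borel" and h: "h \<ge> 0"
    and near: "\<And>t. t \<in> A \<Longrightarrow> \<bar>t - c\<bar> \<le> h"
    and seg: "\<And>t s. t \<in> A \<Longrightarrow> min t c < s \<Longrightarrow> s < max t c \<Longrightarrow> s \<in> B"
  shows "(\<integral>\<^sup>+ t. ennreal ((g t)\<^sup>2) * indicator A t \<partial>lborel) \<le>
     ennreal (4 * h) * ennreal ((g c)\<^sup>2) + ennreal (4 * h\<^sup>2) * (\<integral>\<^sup>+ s. ennreal ((g' s)\<^sup>2) * indicator B s \<partial>lborel)"
proof -
  let ?I = "\<integral>\<^sup>+ s. ennreal ((g' s)\<^sup>2) * indicator B s \<partial>lborel"
  let ?C = "2 * ennreal ((g c)\<^sup>2) + 2 * (ennreal h * ?I)"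
  have pt: "ennreal ((g t)\<^sup>2) \<le> ?C" if t: "t \<in> A" for t
  proof -
    define a b where "a = min t c" and "b = max t c"
    have ab: "a \<le> b" "b - a \<le> h" using near[OF t] by (auto simp: a_def b_def)
    have "(g t)\<^sup>2 \<le> 2 * (g c)\<^sup>2 + 2 * (g t - g c)\<^sup>2"
      using norm_diff_squared_le[of "g c" "- (g t - g c)"] by (simp add: power2_commute)
    also have "(g t - g c)\<^sup>2 = (g b - g a)\<^sup>2"
      by (simp add: a_def b_def min_def max_def power2_commute)
    finally have "ennreal ((g t)\<^sup>2) \<le> ennreal (2 * (g c)\<^sup>2 + 2 * (g b - g a)\<^sup>2)" by (rule ennreal_leI)
    also have "\<dots> = 2 * ennreal ((g c)\<^sup>2) + 2 * ennreal ((g b - g a)\<^sup>2)"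
      by (simp add: ennreal_plus ennreal_mult)
    also have "ennreal ((g b - g a)\<^sup>2) \<le> ennreal (b - a) * (\<integral>\<^sup>+ s. ennreal ((g' s)\<^sup>2) * indicator {a<..<b} s \<partial>lborel)"
      by (rule diff_squared_le_integral_deriv_squared[OF g g' ab(1)])
    also have "\<dots> \<le> ennreal h * ?I"
      using seg[OF t] ab
      by (intro mult_mono nn_integral_mono ennreal_leI) (auto simp: indicator_def a_def b_def)
    finally show ?thesis by (simp add: add_left_mono mult_left_mono)
  qed
  have "(\<integral>\<^sup>+ t. ennreal ((g t)\<^sup>2) * indicator A t \<partial>lborel) \<le> (\<integral>\<^sup>+ t. ?C * indicator {c - h..c + h} t \<partial>lborel)"
    using pt near by (intro nn_integral_mono) (force simp: indicator_def abs_le_iff)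
  also have "\<dots> = ?C * ennreal (2 * h)" using h by (simp add: nn_integral_cmult_indicator)
  also have "\<dots> = ennreal (4 * h) * ennreal ((g c)\<^sup>2) + ennreal (4 * h\<^sup>2) * ?I"
  proof -
    have "ennreal (2 * (2 * h)) = ennreal 2 * ennreal (2 * h)" using h by (intro ennreal_mult) auto
    then have 1: "ennreal (4 * h) = 2 * ennreal (2 * h)" by simp
    have "ennreal (2 * (h * (2 * h))) = ennreal 2 * (ennreal h * ennreal (2 * h))"
      using h by (simp only: ennreal_mult mult_nonneg_nonneg zero_le_numeral)
    then have 2: "ennreal (4 * h\<^sup>2) = 2 * (ennreal h * ennreal (2 * h))"
      by (simp add: power2_eq_square)
    show ?thesis unfolding 1 2 by (simp only: distrib_left distrib_right mult_ac)
  qed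
  finally show ?thesis .
qed

text \<open>Both orders of integration are covered by \<open>e\<close> being \<open>Pair\<close> or its flip.\<close>
lemma nn_integral_slices_le:
  fixes w :: "real \<times> real \<Rightarrow> real"
  assumes w: "C1 w" and e: "e = Pair \<or> e = (\<lambda>x y. (y, x))"
    and S: "S \<in> sets borel" and J: "J \<in> sets borel" and T: "T \<in> borel_measurable borel" and h: "h \<ge> 0"
    and geom: "\<And>x y. e x y \<in> S \<Longrightarrow> x \<in> J \<and> \<bar>y - T x\<bar> \<le> h \<and>
        (\<forall>s. min y (T x) < s \<longrightarrow> s < max y (T x) \<longrightarrow> e x s \<in> Omega_h)"
  shows "(\<integral>\<^sup>+ p. ennreal ((w p)\<^sup>2) * indicator S p \<partial>lborel) \<le>
     ennreal (4 * h) * (\<integral>\<^sup>+ x. ennreal ((w (e x (T x)))\<^sup>2) * indicator J x \<partial>lborel) +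
     ennreal (4 * h\<^sup>2) * (\<integral>\<^sup>+ p. ennreal ((norm (grad w p))\<^sup>2) * indicator Omega_h p \<partial>lborel)"
proof -
  have fub: "(\<integral>\<^sup>+ p. f p \<partial>lborel) = (\<integral>\<^sup>+ x. \<integral>\<^sup>+ y. f (e x y) \<partial>lborel \<partial>lborel)"
    if "f \<in> borel_measurable borel" for f :: "real \<times> real \<Rightarrow> ennreal"
    using e
  proof
    have f: "f \<in> borel_measurable (lborel \<Otimes>\<^sub>M lborel)" using that by (simp add: lborel_prod)
    show ?thesis if "e = Pair"
      using lborel.nn_integral_fst[OF f] that by (simp add: lborel_prod)
    show ?thesis if "e = (\<lambda>x y. (y, x))"
      using lborel_pair.nn_integral_snd[OF f] that by (simp add: lborel_prod)
  qed
  have em: "(\<lambda>x. e (a x) (b x)) \<in> borel_measurable borel"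
    if "a \<in> borel_measurable borel" "b \<in> borel_measurable borel" for a b :: "real \<Rightarrow> real"
    using e that by (auto intro!: borel_measurable_Pair)
  have em2: "(\<lambda>z. e (fst z) (snd z)) \<in> borel_measurable (lborel \<Otimes>\<^sub>M lborel)"
    using e unfolding lborel_prod by (auto intro!: borel_measurable_continuous_onI continuous_intros)
  have wm: "w \<in> borel_measurable borel" and gm: "grad w \<in> borel_measurable borel"
    using C1_continuous[OF w] C1_continuous_grad[OF w] by (auto intro: borel_measurable_continuous_onI)
  have Om: "Omega_h \<in> sets borel" using open_Omega_h by simp
  \<comment> \<open>The direction of the slices. It is a unit vector, so the derivative along a
    slice is bounded by the norm of the full gradient.\<close>
  obtain v where v: "norm v = 1" "\<And>x s. ((\<lambda>s. e x s) has_derivative (\<lambda>t. t *\<^sub>R v)) (at s)"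
  proof (cases "e = Pair")
    case True
    show ?thesis
      by (rule that[of "(0, 1)"]) (auto simp: True norm_Pair intro!: derivative_eq_intros)
  next
    case False
    then have "e = (\<lambda>x y. (y, x))" using e by simp
    then show ?thesis
      by (intro that[of "(1, 0)"]) (auto simp: norm_Pair intro!: derivative_eq_intros)
  qed
  have dw: "((\<lambda>s. w (e x s)) has_real_derivative (grad w (e x s) \<bullet> v)) (at s)" for x s
  proof -
    have "((\<lambda>s. w (e x s)) has_derivative (\<lambda>t. (t *\<^sub>R v) \<bullet> grad w (e x s))) (at s)"
      by (rule has_derivative_compose[OF v(2) C1_has_derivative[OF w]])
    then show ?thesis
      unfolding has_field_derivative_def
      by (rule has_derivative_eq_rhs) (auto simp: inner_commute mult.commute)
  qed
  have cw: "continuous_on UNIV (\<lambda>s. grad w (e x s) \<bullet> v)" for x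
  proof -
    have "continuous_on UNIV (\<lambda>s. e x s)"
      using v(2) by (meson continuous_at_imp_continuous_on has_derivative_continuous)
    then show ?thesis
      by (intro continuous_intros continuous_on_compose2[OF C1_continuous_grad[OF w, of UNIV]]) auto
  qed
  \<comment> \<open>The indicator of \<open>J\<close> may be inserted in the boundary term because
    slices over points outside \<open>J\<close> do not meet \<open>S\<close>.\<close>
  have slice: "(\<integral>\<^sup>+ y. ennreal ((w (e x y))\<^sup>2) * indicator S (e x y) \<partial>lborel) \<le>
      ennreal (4 * h) * (ennreal ((w (e x (T x)))\<^sup>2) * indicator J x) +
      ennreal (4 * h\<^sup>2) * (\<integral>\<^sup>+ y. ennreal ((norm (grad w (e x y)))\<^sup>2) * indicator Omega_h (e x y) \<partial>lborel)"
    (is "?L \<le> _") for x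
  proof (cases "x \<in> J")
    case True
    have "?L = (\<integral>\<^sup>+ y. ennreal ((w (e x y))\<^sup>2) * indicator {y. e x y \<in> S} y \<partial>lborel)"
      by (simp add: indicator_def)
    also have "\<dots> \<le> ennreal (4 * h) * ennreal ((w (e x (T x)))\<^sup>2) +
      ennreal (4 * h\<^sup>2) * (\<integral>\<^sup>+ y. ennreal ((grad w (e x y) \<bullet> v)\<^sup>2) * indicator {y. e x y \<in> Omega_h} y \<partial>lborel)"
    proof (rule nn_integral_slice_le[OF dw cw _ h])
      have "(\<lambda>y. e x y) -` S \<inter> space borel \<in> sets borel"
        by (rule measurable_sets[OF em S]) auto
      then show "{y. e x y \<in> S} \<in> sets borel" by (simp add: vimage_def)
    qed (use geom in auto)
    also have "\<dots> \<le> ennreal (4 * h) * ennreal ((w (e x (T x)))\<^sup>2) +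
      ennreal (4 * h\<^sup>2) * (\<integral>\<^sup>+ y. ennreal ((norm (grad w (e x y)))\<^sup>2) * indicator Omega_h (e x y) \<partial>lborel)"
    proof (intro add_left_mono mult_left_mono nn_integral_mono)
      fix y
      have "\<bar>grad w (e x y) \<bullet> v\<bar>\<^sup>2 \<le> (norm (grad w (e x y)))\<^sup>2"
        using Cauchy_Schwarz_ineq2[of "grad w (e x y)" v] v(1) by (intro power_mono) auto
      then show "ennreal ((grad w (e x y) \<bullet> v)\<^sup>2) * indicator {y. e x y \<in> Omega_h} y
        \<le> ennreal ((norm (grad w (e x y)))\<^sup>2) * indicator Omega_h (e x y)"
        by (auto simp: indicator_def intro!: ennreal_leI)
    qed auto
    finally show ?thesis using True by simp
  next
    case False
    then have "e x y \<notin> S" for y using geom by blast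
    then show ?thesis by simp
  qed
  have Tm: "(\<lambda>x. e x (T x)) \<in> borel_measurable borel" by (rule em[OF _ T]) simp
  have m1: "(\<lambda>x. ennreal ((w (e x (T x)))\<^sup>2) * indicator J x) \<in> borel_measurable lborel"
    using measurable_compose[OF Tm wm] J by simp
  have m2: "(\<lambda>x. \<integral>\<^sup>+ y. ennreal ((norm (grad w (e x y)))\<^sup>2) * indicator Omega_h (e x y) \<partial>lborel) \<in> borel_measurable lborel"
  proof -
    have "(\<lambda>p. ennreal ((norm (grad w p))\<^sup>2) * indicator Omega_h p) \<in> borel_measurable borel"
      using gm Om by simp
    from lborel.borel_measurable_nn_integral_fst[OF measurable_compose[OF em2 this]]
    show ?thesis by simp
  qed
  have "(\<integral>\<^sup>+ p. ennreal ((w p)\<^sup>2) * indicator S p \<partial>lborel) =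
     (\<integral>\<^sup>+ x. \<integral>\<^sup>+ y. ennreal ((w (e x y))\<^sup>2) * indicator S (e x y) \<partial>lborel \<partial>lborel)"
    by (rule fub) (use wm S in simp)
  also have "\<dots> \<le> (\<integral>\<^sup>+ x. ennreal (4 * h) * (ennreal ((w (e x (T x)))\<^sup>2) * indicator J x) +
      ennreal (4 * h\<^sup>2) * (\<integral>\<^sup>+ y. ennreal ((norm (grad w (e x y)))\<^sup>2) * indicator Omega_h (e x y) \<partial>lborel) \<partial>lborel)"
    by (rule nn_integral_mono) (rule slice)
  also have "\<dots> = ennreal (4 * h) * (\<integral>\<^sup>+ x. ennreal ((w (e x (T x)))\<^sup>2) * indicator J x \<partial>lborel) +
     ennreal (4 * h\<^sup>2) * (\<integral>\<^sup>+ x. \<integral>\<^sup>+ y. ennreal ((norm (grad w (e x y)))\<^sup>2) * indicator Omega_h (e x y) \<partial>lborel \<partial>lborel)"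
    using m1 m2 by (simp add: nn_integral_add nn_integral_cmult)
  also have "(\<integral>\<^sup>+ x. \<integral>\<^sup>+ y. ennreal ((norm (grad w (e x y)))\<^sup>2) * indicator Omega_h (e x y) \<partial>lborel \<partial>lborel)
     = (\<integral>\<^sup>+ p. ennreal ((norm (grad w p))\<^sup>2) * indicator Omega_h p \<partial>lborel)"
    by (rule fub[symmetric]) (use gm Om in simp)
  finally show ?thesis .
qed

section \<open>Boundary pieces as graphs, compared with arc length\<close>

lemma borel_measurable_bdry: "bdry \<in> borel_measurable borel"
  unfolding bdry_def[abs_def]
  by (intro measurable_If borel_measurable_Pair borel_measurable_continuous_onI continuous_intros) simp_all

context
  fixes F :: "real \<times> real \<Rightarrow> ennreal"
  assumes F: "F \<in> borel_measurable borel"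
begin

lemma borel_measurable_F_bdry:
  "(\<lambda>s. F (bdry s) * indicator {0..<pi + 2} s) \<in> borel_measurable borel"
  using measurable_compose[OF borel_measurable_bdry F] by simp

lemma nn_integral_diameter_le:
  "(\<integral>\<^sup>+ x. F (x, 0) * indicator {-1<..<1} x \<partial>lborel) \<le>
    (\<integral>\<^sup>+ s. F (bdry s) * indicator {0..<pi + 2} s \<partial>lborel)"
proof -
  have "F (x, 0) * indicator {-1<..<1} x \<le>
      F (bdry (pi + 1 + 1 * x)) * indicator {0..<pi + 2} (pi + 1 + 1 * x)" for x
  proof (cases "x \<in> {-1<..<1}")
    case True
    then have "0 < 1 + x" "x < 1" by auto
    moreover from this have "0 \<le> pi + 1 + x" using pi_gt_zero by linarith
    ultimately have "bdry (pi + 1 + 1 * x) = (x, 0)" "pi + 1 + 1 * x \<in> {0..<pi + 2}"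
      by (auto simp: bdry_def)
    then show ?thesis using True by simp
  qed simp
  then show ?thesis
    unfolding nn_integral_real_affine[OF borel_measurable_F_bdry, of 1 "pi + 1", simplified abs_one ennreal_1 mult_1_left, OF one_neq_zero]
    by (intro nn_integral_mono) simp
qed

lemma nn_integral_arc_le:
  "(\<integral>\<^sup>+ s. F (bdry s) * indicator {0..pi} s \<partial>lborel) \<le>
    (\<integral>\<^sup>+ s. F (bdry s) * indicator {0..<pi + 2} s \<partial>lborel)"
  by (intro nn_integral_mono) (auto simp: indicator_def)

text \<open>The substitutions below use nondecreasing functions. Running through the arc from its
  left end makes the abscissa - cos s increase, and makes the height sin s increase along the left
  quarter.\<close>

lemma nn_integral_reflected_arc_le:
  "(\<integral>\<^sup>+ s. F (bdry (pi - s)) * indicator {0..pi} s \<partial>lborel) \<le>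
    (\<integral>\<^sup>+ s. F (bdry s) * indicator {0..<pi + 2} s \<partial>lborel)"
proof -
  have "(\<integral>\<^sup>+ s. F (bdry s) * indicator {0..<pi + 2} s \<partial>lborel) =
      (\<integral>\<^sup>+ s. F (bdry (pi - s)) * indicator {0..<pi + 2} (pi - s) \<partial>lborel)"
    using nn_integral_real_affine[OF borel_measurable_F_bdry, of "-1" pi] by simp
  moreover have "(\<integral>\<^sup>+ s. F (bdry (pi - s)) * indicator {0..pi} s \<partial>lborel) \<le>
      (\<integral>\<^sup>+ s. F (bdry (pi - s)) * indicator {0..<pi + 2} (pi - s) \<partial>lborel)"
    by (intro nn_integral_mono) (auto simp: indicator_def)
  ultimately show ?thesis by simp
qed

text \<open>Projecting arc length onto a coordinate axis has speed between 0 and 1, so the Jacobian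
  may be dropped. Near points where the graph is vertical this one-sided comparison stays valid, as
  it never divides by the speed.\<close>

lemma nn_integral_substitution_le:
  fixes f :: "real \<Rightarrow> ennreal"
  assumes "f \<in> borel_measurable borel" "a < b"
    and "\<And>x. (g has_real_derivative g' x) (at x)" "continuous_on {a..b} g'"
    and "\<And>x. x \<in> {a..b} \<Longrightarrow> 0 \<le> g' x \<and> g' x \<le> 1"
  shows "(\<integral>\<^sup>+ x. f x * indicator {g a..g b} x \<partial>lborel) \<le> (\<integral>\<^sup>+ x. f (g x) * indicator {a..b} x \<partial>lborel)"
proof -
  have "(\<integral>\<^sup>+ x. f x * indicator {g a..g b} x \<partial>lborel) = (\<integral>\<^sup>+ x. f (g x) * g' x * indicator {a..b} x \<partial>lborel)"
    by (rule nn_integral_substitution_aux) (use assms in auto)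
  also have "\<dots> \<le> (\<integral>\<^sup>+ x. f (g x) * indicator {a..b} x \<partial>lborel)"
  proof (rule nn_integral_mono)
    fix x
    have "f (g x) * ennreal (g' x) \<le> f (g x) * 1" if "x \<in> {a..b}"
      using assms(5)[OF that] by (intro mult_left_mono) auto
    then show "f (g x) * ennreal (g' x) * indicator {a..b} x \<le> f (g x) * indicator {a..b} x"
      by (simp add: indicator_def)
  qed
  finally show ?thesis .
qed

lemma nn_integral_arc_vertical_le:
  "(\<integral>\<^sup>+ x. F (x, sqrt (1 - x\<^sup>2)) * indicator {-1..1} x \<partial>lborel) \<le>
    (\<integral>\<^sup>+ s. F (bdry s) * indicator {0..<pi + 2} s \<partial>lborel)"
proof -
  have "(\<integral>\<^sup>+ x. F (x, sqrt (1 - x\<^sup>2)) * indicator {- cos 0..- cos pi} x \<partial>lborel) \<le>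
      (\<integral>\<^sup>+ s. F (- cos s, sqrt (1 - (- cos s)\<^sup>2)) * indicator {0..pi} s \<partial>lborel)"
  proof (rule nn_integral_substitution_le)
    show "(\<lambda>x. F (x, sqrt (1 - x\<^sup>2))) \<in> borel_measurable borel"
      by (rule measurable_compose[OF _ F]) (intro borel_measurable_continuous_onI continuous_intros)
    show "((\<lambda>s. - cos s) has_real_derivative sin s) (at s)" for s
      by (auto intro!: derivative_eq_intros)
  qed (auto intro!: continuous_intros sin_ge_zero)
  also have "\<dots> \<le> (\<integral>\<^sup>+ s. F (bdry (pi - s)) * indicator {0..pi} s \<partial>lborel)"
  proof (rule nn_integral_mono)
    fix s
    have "bdry (pi - s) = (- cos s, sqrt (1 - (- cos s)\<^sup>2))" if "s \<in> {0..pi}"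
      using that sin_ge_zero[of s] sin_squared_eq[of s] by (simp add: bdry_def real_sqrt_unique)
    then show "F (- cos s, sqrt (1 - (- cos s)\<^sup>2)) * indicator {0..pi} s \<le> F (bdry (pi - s)) * indicator {0..pi} s"
      by (simp add: indicator_def)
  qed
  finally show ?thesis using nn_integral_reflected_arc_le by simp
qed

lemma sqrt_one_minus_sin_squared:
  assumes "s \<in> {0..pi / 2}"
  shows "sqrt (1 - (sin s)\<^sup>2) = cos s"
  using assms cos_ge_zero[of s] cos_squared_eq[of s] by (intro real_sqrt_unique) auto

lemma nn_integral_arc_right_le:
  "(\<integral>\<^sup>+ y. F (sqrt (1 - y\<^sup>2), y) * indicator {0..1} y \<partial>lborel) \<le>
    (\<integral>\<^sup>+ s. F (bdry s) * indicator {0..<pi + 2} s \<partial>lborel)"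
proof -
  have "(\<integral>\<^sup>+ y. F (sqrt (1 - y\<^sup>2), y) * indicator {sin 0..sin (pi / 2)} y \<partial>lborel) \<le>
      (\<integral>\<^sup>+ s. F (sqrt (1 - (sin s)\<^sup>2), sin s) * indicator {0..pi / 2} s \<partial>lborel)"
  proof (rule nn_integral_substitution_le)
    show "(\<lambda>x. F (sqrt (1 - x\<^sup>2), x)) \<in> borel_measurable borel"
      by (rule measurable_compose[OF _ F]) (intro borel_measurable_continuous_onI continuous_intros)
    show "(sin has_real_derivative cos s) (at s)" for s :: real by (rule DERIV_sin)
  qed (auto intro!: continuous_intros cos_ge_zero)
  also have "\<dots> \<le> (\<integral>\<^sup>+ s. F (bdry s) * indicator {0..pi} s \<partial>lborel)"
  proof (rule nn_integral_mono)
    fix s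
    have "bdry s = (sqrt (1 - (sin s)\<^sup>2), sin s)" "s \<in> {0..pi}" if "s \<in> {0..pi / 2}"
      using that sqrt_one_minus_sin_squared[OF that] by (auto simp: bdry_def)
    then show "F (sqrt (1 - (sin s)\<^sup>2), sin s) * indicator {0..pi / 2} s \<le> F (bdry s) * indicator {0..pi} s"
      by (simp add: indicator_def)
  qed
  finally show ?thesis using nn_integral_arc_le by simp
qed

lemma nn_integral_arc_left_le:
  "(\<integral>\<^sup>+ y. F (- sqrt (1 - y\<^sup>2), y) * indicator {0..1} y \<partial>lborel) \<le>
    (\<integral>\<^sup>+ s. F (bdry s) * indicator {0..<pi + 2} s \<partial>lborel)"
proof -
  have "(\<integral>\<^sup>+ y. F (- sqrt (1 - y\<^sup>2), y) * indicator {sin 0..sin (pi / 2)} y \<partial>lborel) \<le>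
      (\<integral>\<^sup>+ s. F (- sqrt (1 - (sin s)\<^sup>2), sin s) * indicator {0..pi / 2} s \<partial>lborel)"
  proof (rule nn_integral_substitution_le)
    show "(\<lambda>x. F (- sqrt (1 - x\<^sup>2), x)) \<in> borel_measurable borel"
      by (rule measurable_compose[OF _ F]) (intro borel_measurable_continuous_onI continuous_intros)
    show "(sin has_real_derivative cos s) (at s)" for s :: real by (rule DERIV_sin)
  qed (auto intro!: continuous_intros cos_ge_zero)
  also have "\<dots> \<le> (\<integral>\<^sup>+ s. F (bdry (pi - s)) * indicator {0..pi} s \<partial>lborel)"
  proof (rule nn_integral_mono)
    fix s
    have "bdry (pi - s) = (- sqrt (1 - (sin s)\<^sup>2), sin s)" "s \<in> {0..pi}" if "s \<in> {0..pi / 2}"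
      using that sqrt_one_minus_sin_squared[OF that] by (auto simp: bdry_def)
    then show "F (- sqrt (1 - (sin s)\<^sup>2), sin s) * indicator {0..pi / 2} s \<le> F (bdry (pi - s)) * indicator {0..pi} s"
      by (simp add: indicator_def)
  qed
  finally show ?thesis using nn_integral_reflected_arc_le by simp
qed

end

section \<open>Poincare inequality in the boundary strip\<close>

lemma arc_slice_geometry:
  fixes r t d :: real
  assumes r: "r > 1 / 2" and in_disc: "t\<^sup>2 + r\<^sup>2 < 1" and near: "t\<^sup>2 + r\<^sup>2 > 1 - 2 * d"
  shows "\<bar>t\<bar> \<le> 1" "r < sqrt (1 - t\<^sup>2)" "sqrt (1 - t\<^sup>2) - r \<le> 2 * d"
    and "\<And>s. 0 < s \<Longrightarrow> s < sqrt (1 - t\<^sup>2) \<Longrightarrow> t\<^sup>2 + s\<^sup>2 < 1"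
proof -
  define T where "T = sqrt (1 - t\<^sup>2)"
  have "r\<^sup>2 \<ge> 0" by simp
  then have t1: "t\<^sup>2 < 1" using in_disc by linarith
  then show "\<bar>t\<bar> \<le> 1" using abs_square_le_1[of t] by simp
  have T2: "T\<^sup>2 = 1 - t\<^sup>2" using t1 by (simp add: T_def)
  have "r\<^sup>2 < T\<^sup>2" using in_disc T2 by simp
  then show rT: "r < sqrt (1 - t\<^sup>2)"
    using t1 by (intro real_less_rsqrt) (simp add: T2)
  \<comment> \<open>Both \<open>r\<close> and \<open>T\<close> exceed 1/2, so T + r is at least 1;
    multiplying by it turns the length T - r into the difference of squares, which the strip
    condition bounds by 2d.\<close>
  have "(T - r) * 1 \<le> (T - r) * (T + r)" using rT r by (intro mult_left_mono) (auto simp: T_def)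
  also have "\<dots> = 1 - t\<^sup>2 - r\<^sup>2" using T2 by (simp add: algebra_simps power2_eq_square)
  finally show "sqrt (1 - t\<^sup>2) - r \<le> 2 * d" using near by (simp add: T_def)
  show "t\<^sup>2 + s\<^sup>2 < 1" if "0 < s" "s < sqrt (1 - t\<^sup>2)" for s
    using power_strict_mono[of s T 2] that T2 by (simp add: T_def)
qed

text \<open>No single coordinate direction is transversal to the whole boundary. The strip is
  therefore covered by four regions, at the diameter and at the top, right and left of the arc, each
  sliced in a direction in which its boundary piece is a graph. Slices reach the boundary within h =
  2d, giving the slice constants 8d and 16 d^2, and four regions contribute.\<close>

lemma strip_estimate:
  assumes w: "C1 w" and d: "0 < d" "d \<le> 1 / 4"
  shows "(\<integral>\<^sup>+ p. ennreal ((w p)\<^sup>2) * indicator (boundary_strip d) p \<partial>lborel) \<le>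
     ennreal (32 * d) * (\<integral>\<^sup>+ s. ennreal ((w (bdry s))\<^sup>2) * indicator {0..<pi + 2} s \<partial>lborel) +
     ennreal (64 * d\<^sup>2) * (\<integral>\<^sup>+ p. ennreal ((norm (grad w p))\<^sup>2) * indicator Omega_h p \<partial>lborel)"
    (is "?L \<le> ennreal (32 * d) * ?bd + ennreal (64 * d\<^sup>2) * ?G")
proof -
  have wm: "w \<in> borel_measurable borel"
    using C1_continuous[OF w] by (auto intro: borel_measurable_continuous_onI)
  then have F: "(\<lambda>p. ennreal ((w p)\<^sup>2)) \<in> borel_measurable borel" by simp
  have h: "0 \<le> 2 * d" using d by simp
  have const: "4 * (2 * d) = 8 * d" "4 * (2 * d)\<^sup>2 = 16 * d\<^sup>2" by (auto simp: power2_eq_square)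
  define near where "near = {p::real \<times> real. 1 - 2 * d < p \<bullet> p}"
  have near: "open near" unfolding near_def by (intro open_Collect_less continuous_intros)
  let ?int = "\<lambda>S. \<integral>\<^sup>+ p. ennreal ((w p)\<^sup>2) * indicator S p \<partial>lborel"
  let ?B = "ennreal (8 * d) * ?bd + ennreal (16 * d\<^sup>2) * ?G"
  have Bmono: "ennreal (8 * d) * X + ennreal (16 * d\<^sup>2) * ?G \<le> ?B" if "X \<le> ?bd" for X
    using that by (intro add_right_mono mult_left_mono) auto
  define S0 where "S0 = Omega_h \<inter> {p. snd p < 2 * d}"
  define S1 where "S1 = Omega_h \<inter> near \<inter> {p. 1 / 2 < snd p}"
  define S2 where "S2 = Omega_h \<inter> near \<inter> {p. 1 / 2 < fst p}"
  define S3 where "S3 = Omega_h \<inter> near \<inter> {p. fst p < - (1 / 2)}"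
  have S: "S0 \<in> sets borel" "S1 \<in> sets borel" "S2 \<in> sets borel" "S3 \<in> sets borel"
    unfolding S0_def S1_def S2_def S3_def
    using near open_Omega_h
    by (auto intro!: borel_open open_Int open_Collect_less continuous_intros)
  have mem: "(x, y) \<in> Omega_h \<longleftrightarrow> x\<^sup>2 + y\<^sup>2 < 1 \<and> 0 < y" for x y by (simp add: Omega_h_def)
  have mem_near: "(x, y) \<in> near \<longleftrightarrow> 1 - 2 * d < x\<^sup>2 + y\<^sup>2" for x y
    by (simp add: near_def power2_eq_square)
  have Tm: "(\<lambda>x::real. sqrt (1 - x\<^sup>2)) \<in> borel_measurable borel"
    "(\<lambda>x::real. - sqrt (1 - x\<^sup>2)) \<in> borel_measurable borel"
    by (intro borel_measurable_continuous_onI continuous_intros)+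
  have "?int S0 \<le> ennreal (4 * (2 * d)) * (\<integral>\<^sup>+ x. ennreal ((w (x, 0))\<^sup>2) * indicator {-1<..<1} x \<partial>lborel)
      + ennreal (4 * (2 * d)\<^sup>2) * ?G"
  proof (rule nn_integral_slices_le[OF w, of Pair S0 "{-1<..<1}" "\<lambda>x. 0"])
    fix x y assume "(x, y) \<in> S0"
    then have xy: "x\<^sup>2 + y\<^sup>2 < 1" "0 < y" "y < 2 * d" by (auto simp: S0_def mem)
    have "x\<^sup>2 < 1" using xy(1) zero_le_power2[of y] by linarith
    then have "x \<in> {-1<..<1}" by (simp add: abs_square_less_1 abs_less_iff)
    moreover have "(x, s) \<in> Omega_h" if "0 < s" "s < y" for s
      using power_strict_mono[of s y 2] that xy by (simp add: mem)
    ultimately show "x \<in> {-1<..<1} \<and> \<bar>y - 0\<bar> \<le> 2 * d \<and>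
        (\<forall>s. min y 0 < s \<longrightarrow> s < max y 0 \<longrightarrow> (x, s) \<in> Omega_h)"
      using xy by auto
  qed (use S h in auto)
  then have 0: "?int S0 \<le> ?B"
    unfolding const using Bmono[OF nn_integral_diameter_le[OF F]] by (rule order_trans)
  have "?int S1 \<le> ennreal (4 * (2 * d)) * (\<integral>\<^sup>+ x. ennreal ((w (x, sqrt (1 - x\<^sup>2)))\<^sup>2) * indicator {-1..1} x \<partial>lborel)
      + ennreal (4 * (2 * d)\<^sup>2) * ?G"
  proof (rule nn_integral_slices_le[OF w, of Pair S1 "{-1..1}" "\<lambda>x. sqrt (1 - x\<^sup>2)"])
    fix x y assume "(x, y) \<in> S1"
    then have xy: "x\<^sup>2 + y\<^sup>2 < 1" "0 < y" "1 / 2 < y" "1 - 2 * d < x\<^sup>2 + y\<^sup>2"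
      by (auto simp: S1_def mem mem_near)
    note geo = arc_slice_geometry[OF xy(3,1,4)]
    show "x \<in> {-1..1} \<and> \<bar>y - sqrt (1 - x\<^sup>2)\<bar> \<le> 2 * d \<and>
        (\<forall>s. min y (sqrt (1 - x\<^sup>2)) < s \<longrightarrow> s < max y (sqrt (1 - x\<^sup>2)) \<longrightarrow> (x, s) \<in> Omega_h)"
      using geo(1-3) geo(4) xy(2) by (auto simp: mem abs_le_iff min_def max_def)
  qed (use S h Tm in auto)
  then have 1: "?int S1 \<le> ?B"
    unfolding const using Bmono[OF nn_integral_arc_vertical_le[OF F]] by (rule order_trans)
  have "?int S2 \<le> ennreal (4 * (2 * d)) * (\<integral>\<^sup>+ y. ennreal ((w (sqrt (1 - y\<^sup>2), y))\<^sup>2) * indicator {0..1} y \<partial>lborel)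
      + ennreal (4 * (2 * d)\<^sup>2) * ?G"
  proof (rule nn_integral_slices_le[OF w, of "\<lambda>x y. (y, x)" S2 "{0..1}" "\<lambda>x. sqrt (1 - x\<^sup>2)"])
    fix y x assume "(x, y) \<in> S2"
    then have xy: "y\<^sup>2 + x\<^sup>2 < 1" "0 < y" "1 / 2 < x" "1 - 2 * d < y\<^sup>2 + x\<^sup>2"
      by (auto simp: S2_def mem mem_near add.commute)
    note geo = arc_slice_geometry[OF xy(3,1,4)]
    show "y \<in> {0..1} \<and> \<bar>x - sqrt (1 - y\<^sup>2)\<bar> \<le> 2 * d \<and>
        (\<forall>s. min x (sqrt (1 - y\<^sup>2)) < s \<longrightarrow> s < max x (sqrt (1 - y\<^sup>2)) \<longrightarrow> (s, y) \<in> Omega_h)"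
      using geo(1-3) geo(4) xy(2,3) by (auto simp: mem abs_le_iff min_def max_def add.commute)
  qed (use S h Tm in auto)
  then have 2: "?int S2 \<le> ?B"
    unfolding const using Bmono[OF nn_integral_arc_right_le[OF F]] by (rule order_trans)
  have "?int S3 \<le> ennreal (4 * (2 * d)) * (\<integral>\<^sup>+ y. ennreal ((w (- sqrt (1 - y\<^sup>2), y))\<^sup>2) * indicator {0..1} y \<partial>lborel)
      + ennreal (4 * (2 * d)\<^sup>2) * ?G"
  proof (rule nn_integral_slices_le[OF w, of "\<lambda>x y. (y, x)" S3 "{0..1}" "\<lambda>x. - sqrt (1 - x\<^sup>2)"])
    fix y x assume "(x, y) \<in> S3"
    \<comment> \<open>The left region is the mirror image of the right one, so the slice geometry is
      applied to - x.\<close>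
    then have xy: "y\<^sup>2 + (- x)\<^sup>2 < 1" "0 < y" "1 / 2 < - x" "1 - 2 * d < y\<^sup>2 + (- x)\<^sup>2"
      by (auto simp: S3_def mem mem_near add.commute)
    note geo = arc_slice_geometry[OF xy(3,1,4)]
    have "(s, y) \<in> Omega_h" if "- sqrt (1 - y\<^sup>2) < s" "s < x" for s
      using geo(4)[of "- s"] that xy(2,3) by (simp add: mem add.commute)
    then show "y \<in> {0..1} \<and> \<bar>x - - sqrt (1 - y\<^sup>2)\<bar> \<le> 2 * d \<and>
        (\<forall>s. min x (- sqrt (1 - y\<^sup>2)) < s \<longrightarrow> s < max x (- sqrt (1 - y\<^sup>2)) \<longrightarrow> (s, y) \<in> Omega_h)"
      using geo(1-3) xy(2,3) by (auto simp: abs_le_iff min_def max_def)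
  qed (use S h Tm in auto)
  then have 3: "?int S3 \<le> ?B"
    unfolding const using Bmono[OF nn_integral_arc_left_le[OF F]] by (rule order_trans)
  \<comment> \<open>A point near the arc that escapes the last three regions has both coordinates at
    most 1/2 in modulus, hence squared norm at most 1/2; this contradicts 1 - 2d \<ge> 1/2, and here
    d \<le> 1/4 is used.\<close>
  have cover: "p \<in> S0 \<union> S1 \<union> S2 \<union> S3" if p: "p \<in> boundary_strip d" for p
  proof (rule ccontr)
    assume n: "p \<notin> S0 \<union> S1 \<union> S2 \<union> S3"
    obtain x y where xy: "p = (x, y)" by force
    have O: "p \<in> Omega_h" using p by (simp add: boundary_strip_def)
    have "p \<in> near" using p n O by (auto simp: boundary_strip_def S0_def near_def)
    then have "\<bar>x\<bar> \<le> 1 / 2" "\<bar>y\<bar> \<le> 1 / 2" and nr: "1 - 2 * d < x\<^sup>2 + y\<^sup>2"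
      using n O xy by (auto simp: S1_def S2_def S3_def mem mem_near abs_le_iff)
    then have "\<bar>x\<bar>\<^sup>2 \<le> (1 / 2)\<^sup>2" "\<bar>y\<bar>\<^sup>2 \<le> (1 / 2)\<^sup>2" using abs_ge_zero by (blast intro: power_mono)+
    then have "x\<^sup>2 \<le> 1 / 4" "y\<^sup>2 \<le> 1 / 4" by (simp_all add: power2_eq_square)
    then show False using nr d by linarith
  qed
  let ?f = "\<lambda>S p. ennreal ((w p)\<^sup>2) * indicator S p"
  have "?L \<le> (\<integral>\<^sup>+ p. (?f S0 p + ?f S1 p) + (?f S2 p + ?f S3 p) \<partial>lborel)"
  proof (rule nn_integral_mono)
    fix p
    have "(indicator (boundary_strip d) p :: ennreal) \<le>
        (indicator S0 p + indicator S1 p) + (indicator S2 p + indicator S3 p)"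
      using cover[of p] by (auto simp: indicator_def)
    then have "ennreal ((w p)\<^sup>2) * indicator (boundary_strip d) p \<le>
        ennreal ((w p)\<^sup>2) * ((indicator S0 p + indicator S1 p) + (indicator S2 p + indicator S3 p))"
      by (rule mult_left_mono) simp
    then show "?f (boundary_strip d) p \<le> (?f S0 p + ?f S1 p) + (?f S2 p + ?f S3 p)"
      by (simp only: distrib_left)
  qed
  also have "\<dots> = (?int S0 + ?int S1) + (?int S2 + ?int S3)"
    using F S by (simp add: nn_integral_add)
  also have "\<dots> \<le> (?B + ?B) + (?B + ?B)" using 0 1 2 3 by (intro add_mono)
  also have "\<dots> = (ennreal (8 * d) + ennreal (8 * d) + (ennreal (8 * d) + ennreal (8 * d))) * ?bd +
      (ennreal (16 * d\<^sup>2) + ennreal (16 * d\<^sup>2) + (ennreal (16 * d\<^sup>2) + ennreal (16 * d\<^sup>2))) * ?G"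
    by (simp only: distrib_right add_ac)
  also have "\<dots> = ennreal (32 * d) * ?bd + ennreal (64 * d\<^sup>2) * ?G"
    using d by (simp add: ennreal_plus[symmetric] del: ennreal_plus)
  finally show ?thesis .
qed

section \<open>Uniqueness of the harmonic extension\<close>

lemma borel_boundary_strip: "boundary_strip d \<in> sets borel"
proof -
  have "boundary_strip d = Omega_h \<inter> ({p. snd p < 2 * d} \<union> {p. 1 - 2 * d < p \<bullet> p})"
    by (auto simp: boundary_strip_def)
  moreover have "open {p::real \<times> real. snd p < 2 * d}" "open {p::real \<times> real. 1 - 2 * d < p \<bullet> p}"
    by (intro open_Collect_less continuous_intros)+
  ultimately show ?thesis using open_Omega_h by (simp add: borel_open open_Int open_Un)
qed

lemma boundary_strip_measurable:
  "(indicator (boundary_strip d) :: _ \<Rightarrow> real) \<in> borel_measurable (lebesgue_on Omega_h)"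
  using borel_boundary_strip
  by (intro measurable_restrict_space1 measurable_completion borel_measurable_indicator) simp

lemma C1_measurable_Omega_h:
  assumes "C1 w"
  shows "w \<in> borel_measurable (lebesgue_on Omega_h)" "grad w \<in> borel_measurable (lebesgue_on Omega_h)"
  using assms
  by (auto intro!: continuous_imp_measurable_on_sets_lebesgue C1_continuous_grad C1_continuous Omega_h_lebesgue)

lemma C1_L2_Omega_h:
  assumes "C1 w"
  shows "L2 (lebesgue_on Omega_h) w" "L2 (lebesgue_on Omega_h) (grad w)"
  using assms by (auto intro!: L2_continuous_Omega_h C1_continuous C1_continuous_grad)

lemma integrable_strip:
  assumes "integrable (lebesgue_on Omega_h) f"
  shows "integrable (lebesgue_on Omega_h) (\<lambda>x. indicator (boundary_strip d) x * f x :: real)"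
  using integrable_mult_bounded[OF assms boundary_strip_measurable[of d], of 1]
  by (simp add: mult.commute indicator_def)

lemma integrable_bdry_C1:
  assumes "C1 w"
  shows "integrable bdry_measure (\<lambda>s. (w (bdry s))\<^sup>2)"
proof -
  have fin: "finite_measure bdry_measure"
    unfolding bdry_measure_def
    by (intro finite_measure_lebesgue_on bounded_set_imp_lmeasurable) auto
  have c: "continuous_on (cball 0 1) (\<lambda>p. (w p)\<^sup>2)"
    by (intro continuous_intros C1_continuous assms)
  obtain B where B: "\<And>p. p \<in> cball 0 1 \<Longrightarrow> \<bar>(w p)\<^sup>2\<bar> \<le> B"
    using continuous_on_compact_abs_bound[OF compact_cball c] by blast
  have "w \<in> borel_measurable borel"
    using C1_continuous[OF assms] by (rule borel_measurable_continuous_onI)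
  then have "(\<lambda>s. (w (bdry s))\<^sup>2) \<in> borel_measurable borel"
    using measurable_compose[OF borel_measurable_bdry] by (intro borel_measurable_power)
  then have m: "(\<lambda>s. (w (bdry s))\<^sup>2) \<in> borel_measurable bdry_measure"
    unfolding bdry_measure_def by (intro measurable_restrict_space1 measurable_completion) simp
  have "integrable bdry_measure (\<lambda>s. 1 * (w (bdry s))\<^sup>2)"
    by (rule integrable_mult_bounded[OF _ m, of _ B])
       (use fin B norm_bdry in \<open>auto simp: space_bdry_measure finite_measure.integrable_const\<close>)
  then show ?thesis by simp
qed

lemma strip_estimate_real:
  assumes w: "C1 w" and d: "0 < d" "d \<le> 1 / 4"
  shows "(LINT x|lebesgue_on Omega_h. indicator (boundary_strip d) x * (w x)\<^sup>2) \<le>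
     32 * d * (LINT s|bdry_measure. (w (bdry s))\<^sup>2) +
     64 * d\<^sup>2 * (LINT x|lebesgue_on Omega_h. (norm (grad w x))\<^sup>2)" (is "?L \<le> 32 * d * ?b + 64 * d\<^sup>2 * ?G")
proof -
  have wm: "w \<in> borel_measurable borel" and gm: "grad w \<in> borel_measurable borel"
    using C1_continuous[OF w] C1_continuous_grad[OF w] by (auto intro: borel_measurable_continuous_onI)
  have i: "integrable (lebesgue_on Omega_h) (\<lambda>x. (w x)\<^sup>2)"
    "integrable (lebesgue_on Omega_h) (\<lambda>x. (norm (grad w x))\<^sup>2)"
    using C1_L2_Omega_h[OF w] by (simp_all add: L2_def)
  have "ennreal ?L = (\<integral>\<^sup>+ x. ennreal (indicator (boundary_strip d) x * (w x)\<^sup>2) * indicator Omega_h x \<partial>lborel)"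
    by (rule ennreal_integral_lebesgue_on)
       (use integrable_strip[OF i(1)] wm borel_boundary_strip Omega_h_lebesgue in auto)
  also have "\<dots> = (\<integral>\<^sup>+ x. ennreal ((w x)\<^sup>2) * indicator (boundary_strip d) x \<partial>lborel)"
    by (intro nn_integral_cong) (auto simp: indicator_def boundary_strip_def)
  also have "\<dots> \<le> ennreal (32 * d) * (\<integral>\<^sup>+ s. ennreal ((w (bdry s))\<^sup>2) * indicator {0..<pi + 2} s \<partial>lborel) +
     ennreal (64 * d\<^sup>2) * (\<integral>\<^sup>+ p. ennreal ((norm (grad w p))\<^sup>2) * indicator Omega_h p \<partial>lborel)"
    by (rule strip_estimate[OF w d])
  also have "(\<integral>\<^sup>+ s. ennreal ((w (bdry s))\<^sup>2) * indicator {0..<pi + 2} s \<partial>lborel) = ennreal ?b"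
    unfolding bdry_measure_def
    by (rule ennreal_integral_lebesgue_on[symmetric])
       (use integrable_bdry_C1[OF w] measurable_compose[OF borel_measurable_bdry wm] in \<open>auto simp: bdry_measure_def\<close>)
  also have "(\<integral>\<^sup>+ p. ennreal ((norm (grad w p))\<^sup>2) * indicator Omega_h p \<partial>lborel) = ennreal ?G"
    by (rule ennreal_integral_lebesgue_on[symmetric]) (use i gm Omega_h_lebesgue in auto)
  also have "ennreal (32 * d) * ennreal ?b + ennreal (64 * d\<^sup>2) * ennreal ?G
      = ennreal (32 * d * ?b + 64 * d\<^sup>2 * ?G)"
    using d by (simp add: ennreal_mult ennreal_plus)
  finally show ?thesis using d by (subst (asm) ennreal_le_iff) auto
qed

text \<open>Testing with \<open>cutoff d\<close> times \<open>u\<close>, the product rule trades the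
  main term for one containing the gradient of the cutoff, which lives in the strip. The indicator
  is inserted into both factors before Cauchy-Schwarz, so that only the energy of \<open>V\<close>
  inside the strip appears; this is the factor that later tends to 0.\<close>

lemma cutoff_test_estimate:
  assumes V: "L2 (lebesgue_on Omega_h) V"
    and orth: "\<And>p. C1_0 Omega_h p \<Longrightarrow> (LINT x|lebesgue_on Omega_h. V x \<bullet> grad p x) = 0"
    and u: "C1 u" and d: "0 < d"
  shows "\<bar>LINT x|lebesgue_on Omega_h. (cutoff d x *\<^sub>R V x) \<bullet> grad u x\<bar> \<le>
    sqrt (LINT x|lebesgue_on Omega_h. indicator (boundary_strip d) x * (norm (V x))\<^sup>2) *
    sqrt ((12 / d)\<^sup>2 * (LINT x|lebesgue_on Omega_h. indicator (boundary_strip d) x * (u x)\<^sup>2))"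
proof -
  let ?M = "lebesgue_on Omega_h"
  let ?i = "indicator (boundary_strip d) :: real \<times> real \<Rightarrow> real"
  have L: "L2 ?M (\<lambda>x. cutoff d x *\<^sub>R grad u x)" "L2 ?M (\<lambda>x. u x *\<^sub>R grad (cutoff d) x)"
    by (intro L2_continuous_Omega_h continuous_intros C1_continuous C1_continuous_grad u C1_cutoff)+
  have "0 = (LINT x|?M. V x \<bullet> grad (\<lambda>x. cutoff d x * u x) x)"
    using orth[OF C1_0_mult[OF C1_0_cutoff[OF d] u]] by simp
  also have "\<dots> = (LINT x|?M. V x \<bullet> (cutoff d x *\<^sub>R grad u x) + V x \<bullet> (u x *\<^sub>R grad (cutoff d) x))"
    by (simp only: grad_mult[OF C1_cutoff u] inner_add_right)
  also have "\<dots> = (LINT x|?M. V x \<bullet> (cutoff d x *\<^sub>R grad u x)) + (LINT x|?M. V x \<bullet> (u x *\<^sub>R grad (cutoff d) x))"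
    by (rule Bochner_Integration.integral_add[OF L2_inner_integrable[OF V L(1)] L2_inner_integrable[OF V L(2)]])
  finally have "(LINT x|?M. V x \<bullet> (cutoff d x *\<^sub>R grad u x)) = - (LINT x|?M. V x \<bullet> (u x *\<^sub>R grad (cutoff d) x))"
    by linarith
  moreover have "(LINT x|?M. (cutoff d x *\<^sub>R V x) \<bullet> grad u x) = (LINT x|?M. V x \<bullet> (cutoff d x *\<^sub>R grad u x))"
    by (simp add: inner_scaleR_left inner_scaleR_right)
  moreover have "(LINT x|?M. V x \<bullet> (u x *\<^sub>R grad (cutoff d) x)) =
      (LINT x|?M. (?i x *\<^sub>R V x) \<bullet> (?i x *\<^sub>R (u x *\<^sub>R grad (cutoff d) x)))"
    by (rule Bochner_Integration.integral_cong)
       (auto simp: indicator_def grad_cutoff_outside_strip[OF d])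
  ultimately have eq: "\<bar>LINT x|?M. (cutoff d x *\<^sub>R V x) \<bullet> grad u x\<bar> =
      \<bar>LINT x|?M. (?i x *\<^sub>R V x) \<bullet> (?i x *\<^sub>R (u x *\<^sub>R grad (cutoff d) x))\<bar>" by simp
  have LL: "L2 ?M (\<lambda>x. ?i x *\<^sub>R V x)" "L2 ?M (\<lambda>x. ?i x *\<^sub>R (u x *\<^sub>R grad (cutoff d) x))"
    by (rule L2_scaleR_bounded[OF V boundary_strip_measurable, of _ 1], simp add: indicator_def,
        rule L2_scaleR_bounded[OF L(2) boundary_strip_measurable, of _ 1], simp add: indicator_def)
  have "(LINT x|?M. (norm (?i x *\<^sub>R (u x *\<^sub>R grad (cutoff d) x)))\<^sup>2) \<le>
      (LINT x|?M. (12 / d)\<^sup>2 * (?i x * (u x)\<^sup>2))"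
  proof (rule integral_mono)
    show "integrable ?M (\<lambda>x. (norm (?i x *\<^sub>R (u x *\<^sub>R grad (cutoff d) x)))\<^sup>2)"
      using LL(2) by (simp add: L2_def)
    have "integrable ?M (\<lambda>x. (u x)\<^sup>2)" using C1_L2_Omega_h(1)[OF u] by (simp add: L2_def)
    then show "integrable ?M (\<lambda>x. (12 / d)\<^sup>2 * (?i x * (u x)\<^sup>2))"
      by (intro integrable_mult_right integrable_strip)
    fix x assume "x \<in> space ?M"
    then have "norm (grad (cutoff d) x) \<le> 12 / d" using norm_grad_cutoff_le[OF d] by simp
    then have "(norm (grad (cutoff d) x))\<^sup>2 \<le> (12 / d)\<^sup>2" by (rule power_mono) simp
    then have "(norm (grad (cutoff d) x))\<^sup>2 * (?i x * (u x)\<^sup>2) \<le> (12 / d)\<^sup>2 * (?i x * (u x)\<^sup>2)"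
      by (rule mult_right_mono) simp
    moreover have "(norm (?i x *\<^sub>R (u x *\<^sub>R grad (cutoff d) x)))\<^sup>2 = (norm (grad (cutoff d) x))\<^sup>2 * (?i x * (u x)\<^sup>2)"
      by (simp add: power_mult_distrib indicator_def)
    ultimately show "(norm (?i x *\<^sub>R (u x *\<^sub>R grad (cutoff d) x)))\<^sup>2 \<le> (12 / d)\<^sup>2 * (?i x * (u x)\<^sup>2)"
      by simp
  qed
  also have "\<dots> = (12 / d)\<^sup>2 * (LINT x|?M. ?i x * (u x)\<^sup>2)" by simp
  finally have n2: "(LINT x|?M. (norm (?i x *\<^sub>R (u x *\<^sub>R grad (cutoff d) x)))\<^sup>2) \<le>
      (12 / d)\<^sup>2 * (LINT x|?M. ?i x * (u x)\<^sup>2)" .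
  have n1: "(LINT x|?M. (norm (?i x *\<^sub>R V x))\<^sup>2) = (LINT x|?M. ?i x * (norm (V x))\<^sup>2)"
    by (rule Bochner_Integration.integral_cong) (auto simp: indicator_def)
  show ?thesis
    unfolding eq
    by (rule order_trans[OF L2_Cauchy_Schwarz[OF LL]], unfold n1)
       (rule mult_left_mono[OF real_sqrt_le_mono[OF n2]], simp)
qed

text \<open>The cutoff gradient is of order \<open>1 / d\<close> on a strip of width \<open>d\<close>, where a function with zero
  trace is of order \<open>d\<close> in \<open>L2\<close>; hence the error of testing with the cut-off function itself is
  controlled by the energy in the strip.\<close>
lemma zero_trace_weakly_harmonic_grad_eq_0:
  fixes w :: "nat \<Rightarrow> real \<times> real \<Rightarrow> real"
  assumes V: "L2 (lebesgue_on Omega_h) V"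
    and orth: "\<And>p. C1_0 Omega_h p \<Longrightarrow> (LINT x|lebesgue_on Omega_h. V x \<bullet> grad p x) = 0"
    and w: "\<And>i. C1 (w i)"
    and a: "(\<lambda>i. LINT x|lebesgue_on Omega_h. (norm (grad (w i) x - V x))\<^sup>2) \<longlonglongrightarrow> 0"
    and b: "(\<lambda>i. LINT s|bdry_measure. (w i (bdry s))\<^sup>2) \<longlonglongrightarrow> 0"
  shows "AE x in lebesgue_on Omega_h. V x = 0"
proof -
  let ?M = "lebesgue_on Omega_h"
  define a' where "a' i = (LINT x|?M. (norm (grad (w i) x - V x))\<^sup>2)" for i
  define b' where "b' i = (LINT s|bdry_measure. (w i (bdry s))\<^sup>2)" for i
  define E where "E = (LINT x|?M. (norm (V x))\<^sup>2)"
  define Es where "Es d = (LINT x|?M. indicator (boundary_strip d) x * (norm (V x))\<^sup>2)" for d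
  have V2: "integrable ?M (\<lambda>x. (norm (V x))\<^sup>2)" using V by (simp add: L2_def)
  have Vm: "V \<in> borel_measurable ?M" using V by (simp add: L2_def)
  have E0: "E \<ge> 0" by (simp add: E_def)
  have cm: "cutoff d \<in> borel_measurable ?M" for d by (rule C1_measurable_Omega_h[OF C1_cutoff])
  have Ld: "L2 ?M (\<lambda>x. grad (w i) x - V x)" for i by (rule L2_diff[OF C1_L2_Omega_h(2)[OF w] V])
  have LcV: "L2 ?M (\<lambda>x. cutoff d x *\<^sub>R V x)" for d
    by (rule L2_scaleR_bounded[OF V cm, of _ 1]) (use cutoff_range in auto)
  have ncV: "(LINT x|?M. (norm (cutoff d x *\<^sub>R V x))\<^sup>2) \<le> E" for d
    unfolding E_def
  proof (rule integral_mono)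
    show "integrable ?M (\<lambda>x. (norm (cutoff d x *\<^sub>R V x))\<^sup>2)" using LcV by (simp add: L2_def)
    fix x
    have "norm (cutoff d x *\<^sub>R V x) \<le> norm (V x)"
      using cutoff_range[of d x] by (simp add: mult_left_le_one_le)
    then show "(norm (cutoff d x *\<^sub>R V x))\<^sup>2 \<le> (norm (V x))\<^sup>2" by (rule power_mono) simp
  qed (rule V2)
  \<comment> \<open>The strip estimate involves the gradients of the approximants; this replaces
    them by the fixed energy \<open>E\<close> and an error that vanishes in the limit.\<close>
  have G: "(LINT x|?M. (norm (grad (w i) x))\<^sup>2) \<le> 2 * a' i + 2 * E" for i
  proof -
    have "(LINT x|?M. (norm (grad (w i) x))\<^sup>2) \<le>
        (LINT x|?M. 2 * (norm (grad (w i) x - V x))\<^sup>2 + 2 * (norm (V x))\<^sup>2)"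
    proof (rule integral_mono)
      show "integrable ?M (\<lambda>x. (norm (grad (w i) x))\<^sup>2)"
        using C1_L2_Omega_h(2)[OF w] by (simp add: L2_def)
      show "integrable ?M (\<lambda>x. 2 * (norm (grad (w i) x - V x))\<^sup>2 + 2 * (norm (V x))\<^sup>2)"
        using Ld V2 by (simp add: L2_def)
      show "(norm (grad (w i) x))\<^sup>2 \<le> 2 * (norm (grad (w i) x - V x))\<^sup>2 + 2 * (norm (V x))\<^sup>2" for x
        using norm_diff_squared_le[of "grad (w i) x - V x" "- V x"] by simp
    qed
    also have "\<dots> = 2 * a' i + 2 * E" using Ld V2 by (simp add: L2_def a'_def E_def)
    finally show ?thesis .
  qed
  \<comment> \<open>Here \<open>d\<close> stays fixed while the approximation index grows. The
    boundary term carries the factor (12/d)^2 * 32 d, which is unbounded as d tends to 0, so it has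
    to be removed by \<open>b' i\<close> tending to 0 beforehand.\<close>
  have fixed_d: "(LINT x|?M. (cutoff d x *\<^sub>R V x) \<bullet> V x) \<le> sqrt (Es d) * sqrt (18432 * E)"
    if d: "0 < d" "d \<le> 1 / 4" for d
  proof (rule LIMSEQ_le)
    show "(\<lambda>i. LINT x|?M. (cutoff d x *\<^sub>R V x) \<bullet> grad (w i) x) \<longlonglongrightarrow> (LINT x|?M. (cutoff d x *\<^sub>R V x) \<bullet> V x)"
    proof (rule LIM_zero_cancel, rule Lim_null_comparison)
      have "\<bar>(LINT x|?M. (cutoff d x *\<^sub>R V x) \<bullet> grad (w i) x) - (LINT x|?M. (cutoff d x *\<^sub>R V x) \<bullet> V x)\<bar>
          \<le> sqrt E * sqrt (a' i)" for i
      proof -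
        have "(LINT x|?M. (cutoff d x *\<^sub>R V x) \<bullet> grad (w i) x) - (LINT x|?M. (cutoff d x *\<^sub>R V x) \<bullet> V x)
            = (LINT x|?M. (cutoff d x *\<^sub>R V x) \<bullet> (grad (w i) x - V x))"
          unfolding inner_diff_right
          by (rule Bochner_Integration.integral_diff[symmetric, OF L2_inner_integrable[OF LcV C1_L2_Omega_h(2)[OF w]]
                L2_inner_integrable[OF LcV V]])
        moreover have "sqrt (LINT x|?M. (norm (cutoff d x *\<^sub>R V x))\<^sup>2) * sqrt (a' i) \<le> sqrt E * sqrt (a' i)"
          by (rule mult_right_mono[OF real_sqrt_le_mono[OF ncV]]) (simp add: a'_def)
        ultimately show ?thesis
          using L2_Cauchy_Schwarz[OF LcV[of d] Ld[of i]] unfolding a'_def by linarith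
      qed
      then show "\<forall>\<^sub>F i in sequentially. norm ((LINT x|?M. (cutoff d x *\<^sub>R V x) \<bullet> grad (w i) x) -
          (LINT x|?M. (cutoff d x *\<^sub>R V x) \<bullet> V x)) \<le> sqrt E * sqrt (a' i)"
        by (simp add: always_eventually)
      have "(\<lambda>i. sqrt E * sqrt (a' i)) \<longlonglongrightarrow> sqrt E * sqrt 0"
        using a unfolding a'_def by (intro tendsto_intros)
      then show "(\<lambda>i. sqrt E * sqrt (a' i)) \<longlonglongrightarrow> 0" by simp
    qed
    have "(\<lambda>i. sqrt (Es d) * sqrt ((12 / d)\<^sup>2 * (32 * d * b' i + 64 * d\<^sup>2 * (2 * a' i + 2 * E))))
        \<longlonglongrightarrow> sqrt (Es d) * sqrt ((12 / d)\<^sup>2 * (32 * d * 0 + 64 * d\<^sup>2 * (2 * 0 + 2 * E)))"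
      using a b unfolding a'_def b'_def by (intro tendsto_intros)
    \<comment> \<open>The powers of d cancel, and 18432 = 144 * 64 * 2.\<close>
    also have "(12 / d)\<^sup>2 * (32 * d * 0 + 64 * d\<^sup>2 * (2 * 0 + 2 * E)) = 18432 * E"
      using d by (simp add: power2_eq_square)
    finally show "(\<lambda>i. sqrt (Es d) * sqrt ((12 / d)\<^sup>2 * (32 * d * b' i + 64 * d\<^sup>2 * (2 * a' i + 2 * E))))
        \<longlonglongrightarrow> sqrt (Es d) * sqrt (18432 * E)" .
    have "(LINT x|?M. (cutoff d x *\<^sub>R V x) \<bullet> grad (w i) x) \<le>
        sqrt (Es d) * sqrt ((12 / d)\<^sup>2 * (32 * d * b' i + 64 * d\<^sup>2 * (2 * a' i + 2 * E)))" for i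
    proof -
      have "(LINT x|?M. indicator (boundary_strip d) x * (w i x)\<^sup>2) \<le>
          32 * d * b' i + 64 * d\<^sup>2 * (LINT x|?M. (norm (grad (w i) x))\<^sup>2)"
        unfolding b'_def by (rule strip_estimate_real[OF w d])
      also have "\<dots> \<le> 32 * d * b' i + 64 * d\<^sup>2 * (2 * a' i + 2 * E)"
        using G[of i] by (intro add_left_mono mult_left_mono) auto
      finally have "(12 / d)\<^sup>2 * (LINT x|?M. indicator (boundary_strip d) x * (w i x)\<^sup>2) \<le>
          (12 / d)\<^sup>2 * (32 * d * b' i + 64 * d\<^sup>2 * (2 * a' i + 2 * E))"
        by (rule mult_left_mono) simp
      from mult_left_mono[OF real_sqrt_le_mono[OF this], of "sqrt (Es d)"]
      show ?thesis
        using cutoff_test_estimate[OF V orth w d(1), of i] unfolding Es_def by simp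
    qed
    then show "\<exists>N. \<forall>i\<ge>N. (LINT x|?M. (cutoff d x *\<^sub>R V x) \<bullet> grad (w i) x) \<le>
        sqrt (Es d) * sqrt ((12 / d)\<^sup>2 * (32 * d * b' i + 64 * d\<^sup>2 * (2 * a' i + 2 * E)))" by blast
  qed
  let ?d = "\<lambda>n. 1 / real (Suc n)"
  have ev: "eventually (\<lambda>n. cutoff (?d n) x = 1 \<and> x \<notin> boundary_strip (?d n)) sequentially"
    if "x \<in> space ?M" for x
    using eventually_compose_filterlim[OF cutoff_eventually_1 filterlim_inverse_Suc_at_right_0, of x] that
    by simp
  have limE: "(\<lambda>n. LINT x|?M. (cutoff (?d n) x *\<^sub>R V x) \<bullet> V x) \<longlonglongrightarrow> E"
    unfolding E_def
  proof (rule integral_dominated_convergence[OF _ _ V2])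
    show "(\<lambda>x. (norm (V x))\<^sup>2) \<in> borel_measurable ?M" using V2 by simp
    show "(\<lambda>x. (cutoff (?d n) x *\<^sub>R V x) \<bullet> V x) \<in> borel_measurable ?M" for n
      using cm Vm by simp
    show "AE x in ?M. (\<lambda>n. (cutoff (?d n) x *\<^sub>R V x) \<bullet> V x) \<longlonglongrightarrow> (norm (V x))\<^sup>2"
    proof (rule AE_I2)
      fix x assume x: "x \<in> space ?M"
      show "(\<lambda>n. (cutoff (?d n) x *\<^sub>R V x) \<bullet> V x) \<longlonglongrightarrow> (norm (V x))\<^sup>2"
        by (rule tendsto_eventually, rule eventually_mono[OF ev[OF x]])
           (simp add: power2_norm_eq_inner)
    qed
    show "AE x in ?M. norm ((cutoff (?d n) x *\<^sub>R V x) \<bullet> V x) \<le> (norm (V x))\<^sup>2" for n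
      using cutoff_range
      by (intro AE_I2) (simp add: abs_mult mult_left_le_one_le flip: power2_norm_eq_inner)
  qed
  \<comment> \<open>Every point of the half disc eventually leaves the strips, so the energy of the
    fixed field in them tends to 0 by dominated convergence; no rate is available or
    required.\<close>
  have "(\<lambda>n. LINT x|?M. indicator (boundary_strip (?d n)) x * (norm (V x))\<^sup>2) \<longlonglongrightarrow> (LINT x|?M. 0)"
  proof (rule integral_dominated_convergence[OF _ _ V2])
    show "(\<lambda>x. indicator (boundary_strip (?d n)) x * (norm (V x))\<^sup>2) \<in> borel_measurable ?M" for n
      using integrable_strip[OF V2] by auto
    show "AE x in ?M. (\<lambda>n. indicator (boundary_strip (?d n)) x * (norm (V x))\<^sup>2) \<longlonglongrightarrow> 0"
    proof (rule AE_I2)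
      fix x assume x: "x \<in> space ?M"
      show "(\<lambda>n. indicator (boundary_strip (?d n)) x * (norm (V x))\<^sup>2) \<longlonglongrightarrow> 0"
        by (rule tendsto_eventually, rule eventually_mono[OF ev[OF x]]) simp
    qed
    show "AE x in ?M. norm (indicator (boundary_strip (?d n)) x * (norm (V x))\<^sup>2) \<le> (norm (V x))\<^sup>2" for n
      by (intro AE_I2) (simp add: indicator_def)
  qed simp
  then have "(\<lambda>n. Es (?d n)) \<longlonglongrightarrow> 0" by (simp add: Es_def)
  then have lim0: "(\<lambda>n. sqrt (Es (?d n)) * sqrt (18432 * E)) \<longlonglongrightarrow> sqrt 0 * sqrt (18432 * E)"
    by (intro tendsto_intros)
  have "E \<le> sqrt 0 * sqrt (18432 * E)"
  proof (rule LIMSEQ_le[OF limE lim0], intro exI[of _ 3] allI impI)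
    \<comment> \<open>From n = 3 on, 1 / (n + 1) is within the range d \<le> 1/4 of the strip
      estimate.\<close>
    fix n :: nat assume "3 \<le> n"
    then have "?d n \<le> 1 / 4" by (intro divide_left_mono) auto
    then show "(LINT x|?M. (cutoff (?d n) x *\<^sub>R V x) \<bullet> V x) \<le> sqrt (Es (?d n)) * sqrt (18432 * E)"
      by (intro fixed_d) auto
  qed
  then have "E = 0" using E0 by simp
  then have "(LINT x|?M. (norm (V x))\<^sup>2) = 0" by (simp only: E_def)
  then show ?thesis
    using integral_nonneg_eq_0_iff_AE[OF V2] by simp
qed

section \<open>Moments of the coefficient\<close>

text \<open>Existence of one solution, with witness \<open>im_pow n\<close>, is what gives the
  choice in \<open>u1\<close> its defining properties.\<close>

lemma u1_sin:
  assumes "n \<ge> 1"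
  shows "weakly_harmonic Omega_h (u1 (\<lambda>\<phi>. sin (real n * \<phi>)))"
    "has_trace (u1 (\<lambda>\<phi>. sin (real n * \<phi>))) (ext0 (\<lambda>\<phi>. sin (real n * \<phi>)))"
  using someI[of "\<lambda>u. weakly_harmonic Omega_h u \<and> has_trace u (ext0 (\<lambda>\<phi>. sin (real n * \<phi>)))" "im_pow n"]
    weakly_harmonic_im_pow has_trace_im_pow[OF assms] unfolding u1_def by auto

text \<open>Only gradients enter the bilinear form, so uniqueness is shown for them. Subtracting the
  C1 function \<open>im_pow n\<close> from the approximants of the chosen solution gives
  approximants whose boundary values tend to 0 in L2, and the difference of the gradients is
  orthogonal to all test gradients.\<close>

lemma weak_grad_u1_sin:
  assumes n: "n \<ge> 1"
  shows "weak_grad Omega_h (u1 (\<lambda>\<phi>. sin (real n * \<phi>))) \<in> borel_measurable (lebesgue_on Omega_h)"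
    and "AE x in lebesgue_on Omega_h. weak_grad Omega_h (u1 (\<lambda>\<phi>. sin (real n * \<phi>))) x = grad (im_pow n) x"
proof -
  let ?f = "\<lambda>\<phi>. sin (real n * \<phi>)"
  let ?M = "lebesgue_on Omega_h"
  define U where "U = weak_grad Omega_h (u1 ?f)"
  have "u1 ?f \<in> H1 Omega_h" using u1_sin(1)[OF n] by (simp add: weakly_harmonic_def)
  then have LU: "L2 ?M U"
    using has_weak_gradient_weak_grad unfolding U_def has_weak_gradient_def by blast
  then show "weak_grad Omega_h (u1 ?f) \<in> borel_measurable ?M" by (simp add: L2_def U_def)
  obtain w where w: "\<And>i. C1 (w i)"
    and lim_grad: "(\<lambda>i. LINT x|?M. (norm (grad (w i) x - U x))\<^sup>2) \<longlonglongrightarrow> 0"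
    and lim_bdry: "(\<lambda>i. LINT s|bdry_measure. (w i (bdry s) - ext0 ?f s)\<^sup>2) \<longlonglongrightarrow> 0"
    using u1_sin(2)[OF n] unfolding has_trace_def U_def by blast
  have LG: "L2 ?M (grad (im_pow n))" by (rule C1_L2_Omega_h(2)[OF C1_im_pow])
  have "AE x in ?M. U x - grad (im_pow n) x = 0"
  proof (rule zero_trace_weakly_harmonic_grad_eq_0[where w = "\<lambda>i x. w i x - im_pow n x"])
    show "L2 ?M (\<lambda>x. U x - grad (im_pow n) x)" by (rule L2_diff[OF LU LG])
    show "C1 (\<lambda>x. w i x - im_pow n x)" for i by (rule C1_diff[OF w C1_im_pow])
    show "(\<lambda>i. LINT x|?M. (norm (grad (\<lambda>x. w i x - im_pow n x) x - (U x - grad (im_pow n) x)))\<^sup>2) \<longlonglongrightarrow> 0"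
      using lim_grad by (simp add: grad_diff[OF w C1_im_pow])
    have "(LINT s|bdry_measure. (w i (bdry s) - im_pow n (bdry s))\<^sup>2) =
        (LINT s|bdry_measure. (w i (bdry s) - ext0 ?f s)\<^sup>2)" for i
      by (rule Bochner_Integration.integral_cong) (auto simp: space_bdry_measure im_pow_bdry[OF _ n])
    then show "(\<lambda>i. LINT s|bdry_measure. (w i (bdry s) - im_pow n (bdry s))\<^sup>2) \<longlonglongrightarrow> 0"
      using lim_bdry by simp
    fix p assume p: "C1_0 Omega_h p"
    then have Lp: "L2 ?M (grad p)" using C1_L2_Omega_h(2) by (simp add: C1_0_def)
    have "(LINT x|?M. U x \<bullet> grad p x) = 0"
      using u1_sin(1)[OF n] p unfolding weakly_harmonic_def U_def by blast
    then show "(LINT x|?M. (U x - grad (im_pow n) x) \<bullet> grad p x) = 0"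
      using L2_inner_integrable[OF LU Lp] L2_inner_integrable[OF LG Lp] integral_grad_im_pow_inner_grad[OF p]
      by (simp add: inner_diff_left)
  qed
  then show "AE x in ?M. weak_grad Omega_h (u1 ?f) x = grad (im_pow n) x"
    by (simp add: U_def)
qed

text \<open>The gradients of \<open>im_pow\<close> are bounded on the half disc, and an L2
  coefficient is integrable on this set of finite measure; hence the sine pairs lie in the domain of
  the partial form.\<close>

lemma DN_inc_lin_sin:
  fixes \<gamma> :: "real \<times> real \<Rightarrow> real"
  assumes \<gamma>: "L2 (lebesgue_on Omega_h) \<gamma>" and n: "n \<ge> 1" and k: "k \<ge> 1"
  shows "integrable (lebesgue_on Omega_h) (\<lambda>x. \<gamma> x * (grad (im_pow n) x \<bullet> grad (im_pow k) x))"
    and "DN_inc_lin \<gamma> (\<lambda>\<phi>. sin (real n * \<phi>)) (\<lambda>\<phi>. sin (real k * \<phi>)) =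
      Some (LINT x|lebesgue_on Omega_h. \<gamma> x * (grad (im_pow n) x \<bullet> grad (im_pow k) x))"
proof -
  let ?M = "lebesgue_on Omega_h"
  let ?U = "\<lambda>n. weak_grad Omega_h (u1 (\<lambda>\<phi>. sin (real n * \<phi>)))"
  let ?F = "\<lambda>x. \<gamma> x * (?U n x \<bullet> ?U k x)"
  let ?G = "\<lambda>x. \<gamma> x * (grad (im_pow n) x \<bullet> grad (im_pow k) x)"
  show G: "integrable ?M ?G"
    by (rule integrable_mult_continuous[OF L2_integrable_Omega_h[OF \<gamma>] Omega_h_lebesgue
          Omega_h_subset_cball compact_cball])
       (intro continuous_on_inner C1_continuous_grad C1_im_pow)
  have F: "?F \<in> borel_measurable ?M"
    using \<gamma> weak_grad_u1_sin(1)[OF n] weak_grad_u1_sin(1)[OF k]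
    by (intro borel_measurable_times borel_measurable_inner) (auto simp: L2_def)
  have ae: "AE x in ?M. ?F x = ?G x"
    using weak_grad_u1_sin(2)[OF n] weak_grad_u1_sin(2)[OF k] by eventually_elim simp
  have "integrable ?M ?F"
    using G integrable_cong_AE[OF F borel_measurable_integrable[OF G] ae] by simp
  moreover have "integral\<^sup>L ?M ?F = integral\<^sup>L ?M ?G"
    by (rule integral_cong_AE[OF F borel_measurable_integrable[OF G] ae])
  ultimately show "DN_inc_lin \<gamma> (\<lambda>\<phi>. sin (real n * \<phi>)) (\<lambda>\<phi>. sin (real k * \<phi>)) = Some (integral\<^sup>L ?M ?G)"
    unfolding DN_inc_lin_def Let_def using H_half_ext0_sin[OF n] H_half_ext0_sin[OF k] by simp
qed

text \<open>These are the real polynomials in \<open>x\<close> and \<open>y\<^sup>2\<close>.\<close>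
inductive even_poly :: "(real \<times> real \<Rightarrow> real) \<Rightarrow> bool" where
  monom: "even_poly (\<lambda>p. c * Re (Complex (fst p) (snd p) ^ a * cnj (Complex (fst p) (snd p)) ^ b))"
| add: "even_poly f \<Longrightarrow> even_poly g \<Longrightarrow> even_poly (\<lambda>p. f p + g p)"

text \<open>Re A * Re B is the mean of Re (A B) and Re (A cnj B). Conjugating a monomial exchanges
  its two exponents, so both terms are monomials again.\<close>

lemma even_poly_mult_monom:
  assumes "even_poly f"
  shows "even_poly (\<lambda>p. f p * (d * Re (Complex (fst p) (snd p) ^ m * cnj (Complex (fst p) (snd p)) ^ n)))"
  using assms
proof induction
  case (monom c a b)
  have Re: "Re A * Re B = (Re (A * B) + Re (A * cnj B)) / 2" for A B by simp
  have "(\<lambda>p. (c * d / 2) * Re (Complex (fst p) (snd p) ^ (a + m) * cnj (Complex (fst p) (snd p)) ^ (b + n)) +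
      (c * d / 2) * Re (Complex (fst p) (snd p) ^ (a + n) * cnj (Complex (fst p) (snd p)) ^ (b + m))) =
    (\<lambda>p. c * Re (Complex (fst p) (snd p) ^ a * cnj (Complex (fst p) (snd p)) ^ b) *
      (d * Re (Complex (fst p) (snd p) ^ m * cnj (Complex (fst p) (snd p)) ^ n)))"
  proof
    fix p :: "real \<times> real"
    define z where "z = Complex (fst p) (snd p)"
    let ?A = "z ^ a * cnj z ^ b" and ?B = "z ^ m * cnj z ^ n"
    have "z ^ (a + m) * cnj z ^ (b + n) = ?A * ?B" "z ^ (a + n) * cnj z ^ (b + m) = ?A * cnj ?B"
      by (simp_all add: power_add mult_ac)
    moreover have "c * Re ?A * (d * Re ?B) = (c * d) * ((Re (?A * ?B) + Re (?A * cnj ?B)) / 2)"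
      unfolding Re[symmetric] by simp
    ultimately show "(c * d / 2) * Re (z ^ (a + m) * cnj z ^ (b + n)) + (c * d / 2) * Re (z ^ (a + n) * cnj z ^ (b + m)) =
        c * Re ?A * (d * Re ?B)"
      by (simp only: distrib_left times_divide_eq_left times_divide_eq_right add_divide_distrib)
  qed
  from back_subst[of even_poly, OF even_poly.add[OF even_poly.monom even_poly.monom] this]
  show ?case .
next
  case (add f g)
  then show ?case using even_poly.add by (simp add: distrib_right)
qed

lemma even_poly_mult: "even_poly g \<Longrightarrow> even_poly f \<Longrightarrow> even_poly (\<lambda>p. f p * g p)"
proof (induction rule: even_poly.induct)
  case (monom c a b)
  then show ?case by (rule even_poly_mult_monom)
next
  case (add g h)
  then show ?case using even_poly.add by (simp add: distrib_left)
qed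

lemma function_ring_even_poly:
  assumes K: "compact K" "K \<subseteq> {p. 0 \<le> snd p}"
  shows "function_ring_on (Collect even_poly) K"
proof
  show "compact K" by fact
  fix f assume f: "f \<in> Collect even_poly"
  then have "even_poly f" by simp
  then show "continuous_on K f"
    by induction (auto intro!: continuous_intros simp: Complex_eq)
next
  fix c :: real
  show "(\<lambda>_. c) \<in> Collect even_poly" using even_poly.monom[of c 0 0] by simp
next
  fix x y assume xy: "x \<in> K" "y \<in> K" "x \<noteq> y"
  show "\<exists>f\<in>Collect even_poly. f x \<noteq> f y"
  proof (cases "fst x = fst y")
    case False
    then show ?thesis
      using even_poly.monom[of 1 1 0] by (intro bexI[of _ "\<lambda>p. fst p"]) auto
  next
    case True
    then have "snd x \<noteq> snd y" using xy by (simp add: prod_eq_iff)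
    moreover have "0 \<le> snd x" "0 \<le> snd y" using xy K by auto
    \<comment> \<open>Only here does the sign condition on \<open>K\<close> enter: conjugate points
      have the same squared height.\<close>
    ultimately have "(snd x)\<^sup>2 \<noteq> (snd y)\<^sup>2" by (simp add: power2_eq_iff_nonneg)
    then show ?thesis
      using even_poly.monom[of 1 1 1] True
      by (intro bexI[of _ "\<lambda>p. fst p * fst p + snd p * snd p"]) (auto simp: power2_eq_square)
  qed
qed (auto intro: even_poly.add even_poly_mult)

lemma compact_upper_half_disc: "compact (cball 0 1 \<inter> {p::real \<times> real. 0 \<le> snd p})"
  by (intro compact_Int_closed compact_cball closed_Collect_le continuous_intros)

lemma Omega_h_subset_half_disc: "Omega_h \<subseteq> cball 0 1 \<inter> {p. 0 \<le> snd p}"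
  using Omega_h_subset_cball by (auto simp: Omega_h_iff)

lemma AE_eq_of_grad_im_pow_moments:
  assumes \<delta>: "integrable (lebesgue_on Omega_h) \<delta>"
    and moments: "\<And>n k. n \<ge> 1 \<Longrightarrow> k \<ge> 1 \<Longrightarrow>
      (LINT x|lebesgue_on Omega_h. \<delta> x * (grad (im_pow n) x \<bullet> grad (im_pow k) x)) = 0"
  shows "AE x in lebesgue_on Omega_h. \<delta> x = 0"
proof (rule AE_eq_0_of_function_ring[OF function_ring_even_poly[OF compact_upper_half_disc]
      Omega_h_subset_half_disc Omega_h_lebesgue \<delta>])
  let ?M = "lebesgue_on Omega_h"
  fix q assume "q \<in> Collect even_poly"
  then have "even_poly q" by simp
  \<comment> \<open>Integrability is carried through the induction because additivity of the
    integral in the sum case depends on it.\<close>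
  then have "integrable ?M (\<lambda>x. \<delta> x * q x) \<and> (LINT x|?M. \<delta> x * q x) = 0"
  proof induction
    case (monom c a b)
    \<comment> \<open>Differentiation lowers each exponent by one, so the exponents a, b \<ge> 0
      correspond to the indices a + 1, b + 1 \<ge> 1: the given moments reach every monomial,
      including the constants.\<close>
    have eq: "(\<lambda>x. \<delta> x * (c * Re (Complex (fst x) (snd x) ^ a * cnj (Complex (fst x) (snd x)) ^ b))) =
        (\<lambda>x. (c / (real (Suc a) * real (Suc b))) * (\<delta> x * (grad (im_pow (Suc a)) x \<bullet> grad (im_pow (Suc b)) x)))"
      by (simp add: grad_im_pow_inner fun_eq_iff del: of_nat_Suc)
    have "integrable ?M (\<lambda>x. \<delta> x * (grad (im_pow (Suc a)) x \<bullet> grad (im_pow (Suc b)) x))"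
      by (rule integrable_mult_continuous[OF \<delta> Omega_h_lebesgue Omega_h_subset_cball compact_cball])
         (intro continuous_on_inner C1_continuous_grad C1_im_pow)
    then show ?case unfolding eq using moments[of "Suc a" "Suc b"] by simp
  next
    case (add f g)
    then show ?case by (simp add: distrib_left)
  qed
  then show "(LINT x|?M. \<delta> x * q x) = 0" by simp
qed auto

theorem theorem2:
  fixes \<gamma>1 \<gamma>2 :: "real \<times> real \<Rightarrow> real"
  assumes "L2 (lebesgue_on Omega_h) \<gamma>1"
    and "L2 (lebesgue_on Omega_h) \<gamma>2"
  shows "(DN_inc_lin \<gamma>1 = DN_inc_lin \<gamma>2 \<longrightarrow>
           (AE x in lebesgue_on Omega_h. \<gamma>1 x = \<gamma>2 x)) \<and>
         ((\<forall>n k :: nat. n \<ge> 1 \<longrightarrow> k \<ge> 1 \<longrightarrow>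
            DN_inc_lin \<gamma>1 (\<lambda>\<phi>. sin (real n * \<phi>)) (\<lambda>\<phi>. sin (real k * \<phi>)) =
            DN_inc_lin \<gamma>2 (\<lambda>\<phi>. sin (real n * \<phi>)) (\<lambda>\<phi>. sin (real k * \<phi>))) \<longrightarrow>
           (AE x in lebesgue_on Omega_h. \<gamma>1 x = \<gamma>2 x))"
    (is "_ \<and> (?P \<longrightarrow> ?AE)")
proof -
  \<comment> \<open>Equality of the two partial forms includes equality of their option values at
    the sine pairs, so both claims reduce to this one.\<close>
  have main: ?AE if DN: ?P
  proof -
    let ?M = "lebesgue_on Omega_h"
    have "AE x in ?M. \<gamma>1 x - \<gamma>2 x = 0"
    proof (rule AE_eq_of_grad_im_pow_moments)
      show "integrable ?M (\<lambda>x. \<gamma>1 x - \<gamma>2 x)"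
        using assms L2_integrable_Omega_h by (intro Bochner_Integration.integrable_diff)
      fix n k :: nat assume nk: "n \<ge> 1" "k \<ge> 1"
      have "(LINT x|?M. \<gamma>1 x * (grad (im_pow n) x \<bullet> grad (im_pow k) x)) =
          (LINT x|?M. \<gamma>2 x * (grad (im_pow n) x \<bullet> grad (im_pow k) x))"
        using DN nk DN_inc_lin_sin(2)[OF assms(1) nk] DN_inc_lin_sin(2)[OF assms(2) nk] by simp
      then show "(LINT x|?M. (\<gamma>1 x - \<gamma>2 x) * (grad (im_pow n) x \<bullet> grad (im_pow k) x)) = 0"
        using DN_inc_lin_sin(1)[OF assms(1) nk] DN_inc_lin_sin(1)[OF assms(2) nk]
        by (simp add: left_diff_distrib)
    qed
    then show ?thesis by simp
  qed
  show ?thesis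
  proof (intro conjI impI)
    assume "DN_inc_lin \<gamma>1 = DN_inc_lin \<gamma>2"
    then have ?P by simp
    then show ?AE by (rule main)
  next
    assume ?P
    then show ?AE by (rule main)
  qed
qed

end
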